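(* Let $f(w)=\sum_{j=1}^n\prod_{h=1}^d w_h^{a_{hj}}$ be a non-negative sum-of-products polynomial in $d$ variables with $n$ terms, with multi-index matrix $A_f=(a_{hj})\in\mathbb N_0^{d\times n}$, and let $g(w)=\prod_{h=1}^d w_h^{s_h-1}$ with $s_h>0$ for all $h$. Let $W$ be a sufficiently large compact set. For the largest pole $-\lambda$ of the zeta function $$\zeta(z)=\int_W f(w)^z|g(w)|\,dw$$ the following holds: $$\frac1\lambda\ \ge\ \max_{\alpha\in S_{d-1}}\left\{\min_{j=1,\dots,n}\left(\sum_{h=1}^d\alpha_h\frac{a_{hj}}{s_h}\right)\right\},$$ where $S_{d-1}=\{\alpha\in\mathbb R^d:\alpha_h\ge0\ (h=1,\dots,d),\ \sum_{h=1}^d\alpha_h=1\}$. For $n=2$, equality holds. In particular, for $n=2$, define $$\nu_h=\frac{\max(a_{h1},a_{h2})}{s_h},\qquad \mu_h=\frac{\min(a_{h1},a_{h2})}{s_h}\qquad(h=1,\dots,d),$$ $$H=\left\{(h,h')\in\{1,\dots,d\}^2:\ h\neq h',\ \nu_h-\mu_h>0,\ \nu_{h'}-\mu_{h'}>0\right\}.$$ Then $$\frac1\lambda=\max\left\{\max_{h}\mu_h,\ \max_{(h,h')\in H}\left(\frac{\nu_h\nu_{h'}-\mu_h\mu_{h'}}{\nu_h+\nu_{h'}-\mu_h-\mu_{h'}}\right)\right\}.$$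
   Context: $\mathbb N_0$ is the set of non-negative integers. A sum-of-products polynomial with $d$ variables and $n$ terms is $\sum_{j=1}^n\prod_{h=1}^d w_h^{a_{hj}}$ with pairwise distinct exponent vectors $(a_{1j},\dots,a_{dj})\in\mathbb N_0^d$ and all coefficients equal to $1$; non-negative means $f\ge0$ on $\mathbb R^d$. The poles of the zeta function are those of its meromorphic continuation to $\mathbb C$. The convention $1/\infty=0$ is used (with $\lambda=\infty$ when there is no pole).
   Formalization: The set H additionally requires the two terms to be ordered oppositely in h and h' (a_h1<a_h2 and a_h'1>a_h'2, or vice versa); as printed the closed formula fails, e.g. for f=1+w1²w2² with s=(1,1), where 1/λ=0 but the formula gives 1. *)

theory Defs
  imports "HOL-Complex_Analysis.Complex_Analysis"
begin

text \<open>
  Variables are indexed by a finite type \<open>'d\<close> (of cardinality $d$), terms by \<open>{1..n}\<close>;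
  \<open>a h j\<close> is the entry $a_{hj}$ of the multi-index matrix.
\<close>

definition sop :: "nat \<Rightarrow> ('d::finite \<Rightarrow> nat \<Rightarrow> nat) \<Rightarrow> real ^ 'd \<Rightarrow> real" where
  "sop n a w = (\<Sum>j=1..n. \<Prod>h\<in>UNIV. (w $ h) ^ a h j)"

definition nonneg_sop :: "nat \<Rightarrow> ('d::finite \<Rightarrow> nat \<Rightarrow> nat) \<Rightarrow> bool" where
  "nonneg_sop n a \<longleftrightarrow> n \<ge> 1 \<and> inj_on (\<lambda>j h. a h j) {1..n} \<and> (\<forall>w. sop n a w \<ge> 0)"

text \<open>
  The absolute value $|g(w)|$ of $g(w) = \prod_h w_h^{s_h-1}$. Since the $s_h$ are real, it is
  written as $\prod_h |w_h|^{s_h-1}$. (The value \<open>0 powr _ = 0\<close> only matters on a null set.)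
\<close>

definition abs_g :: "('d::finite \<Rightarrow> real) \<Rightarrow> real ^ 'd \<Rightarrow> real" where
  "abs_g s w = (\<Prod>h\<in>UNIV. \<bar>w $ h\<bar> powr (s h - 1))"

text \<open>
  The zeta integral. It converges absolutely for \<open>Re z > 0\<close> when \<open>W\<close> is compact and all \<open>s h > 0\<close>;
  the Bochner integral is 0 by convention wherever it does not converge.
\<close>

definition zeta_integral ::
  "nat \<Rightarrow> ('d::finite \<Rightarrow> nat \<Rightarrow> nat) \<Rightarrow> ('d \<Rightarrow> real) \<Rightarrow> (real ^ 'd) set \<Rightarrow> complex \<Rightarrow> complex" where
  "zeta_integral n a s W z =
     (LINT w:W|lborel. complex_of_real (sop n a w) powr z * complex_of_real (abs_g s w))"

definition zeta_continuation ::
  "nat \<Rightarrow> ('d::finite \<Rightarrow> nat \<Rightarrow> nat) \<Rightarrow> ('d \<Rightarrow> real) \<Rightarrow> (real ^ 'd) set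
     \<Rightarrow> (complex \<Rightarrow> complex) \<Rightarrow> bool" where
  "zeta_continuation n a s W \<zeta> \<longleftrightarrow>
     \<zeta> meromorphic_on UNIV \<and> (\<forall>z. Re z > 0 \<longrightarrow> \<zeta> z = zeta_integral n a s W z)"

text \<open>
  \<open>-l\<close> is the largest pole of \<open>\<zeta>\<close>, with \<open>l = \<infinity>\<close> if there is no pole. Poles are compared by
  their real parts, so that non-real poles are not excluded by definition.
\<close>

definition largest_pole_at_minus :: "(complex \<Rightarrow> complex) \<Rightarrow> ereal \<Rightarrow> bool" where
  "largest_pole_at_minus \<zeta> l \<longleftrightarrow>
     (l = \<infinity> \<and> (\<nexists>p. is_pole \<zeta> p)) \<or>
     (\<exists>x::real. l = ereal x \<and> is_pole \<zeta> (- complex_of_real x) \<and>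
        (\<forall>p. is_pole \<zeta> p \<longrightarrow> Re p \<le> - x))"

definition prob_simplex :: "(real ^ 'd::finite) set" where
  "prob_simplex = {\<alpha>. (\<forall>h. \<alpha> $ h \<ge> 0) \<and> (\<Sum>h\<in>UNIV. \<alpha> $ h) = 1}"

text \<open>
  The supremum is a maximum: for \<open>n \<ge> 1\<close> the inner minimum is continuous in \<open>\<alpha>\<close>, and the
  simplex is compact and nonempty.
\<close>

definition maxmin :: "nat \<Rightarrow> ('d::finite \<Rightarrow> nat \<Rightarrow> nat) \<Rightarrow> ('d \<Rightarrow> real) \<Rightarrow> real" where
  "maxmin n a s =
     (SUP \<alpha>\<in>prob_simplex. MIN j\<in>{1..n}. \<Sum>h\<in>UNIV. \<alpha> $ h * (real (a h j) / s h))"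

definition \<nu> :: "('d \<Rightarrow> nat \<Rightarrow> nat) \<Rightarrow> ('d \<Rightarrow> real) \<Rightarrow> 'd \<Rightarrow> real" where
  "\<nu> a s h = real (max (a h 1) (a h 2)) / s h"

definition \<mu> :: "('d \<Rightarrow> nat \<Rightarrow> nat) \<Rightarrow> ('d \<Rightarrow> real) \<Rightarrow> 'd \<Rightarrow> real" where
  "\<mu> a s h = real (min (a h 1) (a h 2)) / s h"

text \<open>
  The last condition says that the two terms are ordered oppositely in the variables \<open>h\<close> and
  \<open>h'\<close>. The published definition omits it, which makes the closed formula false: for
  $f = w_1^2 w_2^2 + w_1^4 w_2^4$ and $s = (1,1)$ one has $1/\lambda = 2$, whereas the pair
  $(1,2)$ would contribute $(16-4)/4 = 3$. If the two terms are ordered oppositely, the fraction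
  is the common value of both linear forms at their intersection on the edge from $e_h$ to
  $e_{h'}$ of the simplex; if not, they do not meet in the interior of that edge.
\<close>

definition H_pairs :: "('d \<Rightarrow> nat \<Rightarrow> nat) \<Rightarrow> ('d \<Rightarrow> real) \<Rightarrow> ('d \<times> 'd) set" where
  "H_pairs a s = {(h, h'). h \<noteq> h' \<and> \<nu> a s h - \<mu> a s h > 0 \<and> \<nu> a s h' - \<mu> a s h' > 0 \<and>
                   (a h 1 < a h 2) \<noteq> (a h' 1 < a h' 2)}"

text \<open>A single \<open>Max\<close> over the union, so that an empty \<open>H_pairs\<close> contributes nothing.\<close>

definition two_term_value :: "('d::finite \<Rightarrow> nat \<Rightarrow> nat) \<Rightarrow> ('d \<Rightarrow> real) \<Rightarrow> real" where
  "two_term_value a s =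
     Max (range (\<mu> a s) \<union>
          (\<lambda>(h, h'). (\<nu> a s h * \<nu> a s h' - \<mu> a s h * \<mu> a s h') /
                      (\<nu> a s h + \<nu> a s h' - \<mu> a s h - \<mu> a s h')) ` H_pairs a s)"

end

theory Submission
  imports Defs
begin

text \<open>
  Write \<open>\<zeta>\<close> as the Mellin type integral \<open>\<integral> F\<^sup>z G\<close> with \<open>F, G \<ge> 0\<close>. Around \<open>z = 1\<close> its Taylor
  coefficients are \<open>\<integral> F (ln F)\<^sup>k G / k!\<close>, so (as for Landau's theorem on Dirichlet series) the radius
  of convergence of the Taylor series decides for which \<open>x\<close> the integral of \<open>F\<^bsup>- x\<^esup> G\<close> is finite:
  no pole to the right of \<open>- x\<close> forces convergence for all smaller exponents, and convergence
  excludes poles in a disc around \<open>1\<close>.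

  For \<open>\<alpha>\<close> in the simplex with minimum \<open>m\<close>, on the box \<open>0 \<le> w\<^sub>h \<le> t\<^bsup>\<alpha>\<^sub>h / s\<^sub>h\<^esup>\<close> one has
  \<open>f \<le> n t\<^sup>m\<close> while \<open>g\<close> has mass proportional to \<open>t\<close>; as \<open>t \<rightarrow> 0\<close> the integral diverges if
  \<open>m x > 1\<close>, which gives the inequality. For \<open>n = 2\<close> non-negativity makes all exponents even. Then
  \<open>f\<close> dominates the monomial \<open>\<Prod> (\<bar>w\<^sub>h\<bar> / R)\<^bsup>M s\<^sub>h\<^esup>\<close> with \<open>M\<close> the max-min value, and the integral
  converges if \<open>M x < 1\<close>.
\<close>

subsection \<open>Landau's theorem for Mellin type integrals\<close>

text \<open>The domain of integration is meant to be absorbed into \<open>G\<close>. As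
  \<open>0 powr 0 = 0\<close>, the exponent 0 in \<open>integrable_powr_nonneg\<close> asks for
  integrability of \<open>G\<close> only where \<open>F\<close> is positive.\<close>

locale mellin_pair =
  fixes M :: "'a measure" and F G :: "'a \<Rightarrow> real"
  assumes F_measurable [measurable]: "F \<in> borel_measurable M"
    and G_measurable [measurable]: "G \<in> borel_measurable M"
    and F_nonneg: "\<And>x. F x \<ge> 0"
    and G_nonneg: "\<And>x. G x \<ge> 0"
    and integrable_powr_nonneg: "\<And>\<sigma>. \<sigma> \<ge> 0 \<Longrightarrow> integrable M (\<lambda>x. F x powr \<sigma> * G x)"
begin

definition mellin :: "complex \<Rightarrow> complex" where
  "mellin z = (LINT x|M. complex_of_real (F x) powr z * complex_of_real (G x))"

text \<open>Read off from F^(1+u) = F exp (u ln F). The factor \<open>F x\<close> makes the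
  integrand vanish at zeros of \<open>F\<close>, whatever the value of \<open>ln 0\<close>.\<close>

definition mellin_coeff :: "nat \<Rightarrow> real" where
  "mellin_coeff k = (LINT x|M. F x * ln (F x) ^ k / fact k * G x)"

lemma cosh_ln_eq: "2 * (F x * cosh (r * ln (F x))) = F x powr (1 + r) + F x powr (1 - r)"
proof (cases "F x = 0")
  case False
  then have "F x > 0" using F_nonneg[of x] by linarith
  then have "F x powr (1 + r) = F x * exp (r * ln (F x))" "F x powr (1 - r) = F x * exp (- (r * ln (F x)))"
    by (simp_all add: powr_add powr_diff powr_def[of _ r] exp_minus divide_inverse)
  then show ?thesis by (simp add: cosh_def field_simps)
qed simp

lemma exp_abs_ln_le: "F x * exp (\<bar>r * ln (F x)\<bar>) \<le> F x powr (1 + r) + F x powr (1 - r)"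
proof -
  have "exp \<bar>y\<bar> \<le> 2 * cosh y" for y :: real
    by (cases "y \<ge> 0") (auto simp: cosh_def)
  then have "F x * exp (\<bar>r * ln (F x)\<bar>) \<le> F x * (2 * cosh (r * ln (F x)))"
    using F_nonneg[of x] by (intro mult_left_mono) auto
  then show ?thesis using cosh_ln_eq[of x r] by simp
qed

text \<open>The full series is F exp |r ln F| G, and exp |y| is at most exp y + exp (- y). The bound
  does not depend on \<open>n\<close>, so it can serve as a common majorant of all partial
  sums.\<close>

lemma power_series_term_le:
  assumes "r \<ge> 0"
  shows "(\<Sum>k<n. \<bar>F x * ln (F x) ^ k / fact k * G x\<bar> * r ^ k)
           \<le> (F x powr (1 + r) + F x powr (1 - r)) * G x"
proof -
  have "(\<Sum>k<n. \<bar>F x * ln (F x) ^ k / fact k * G x\<bar> * r ^ k)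
        = F x * G x * (\<Sum>k<n. \<bar>r * ln (F x)\<bar> ^ k /\<^sub>R fact k)"
    using assms F_nonneg[of x] G_nonneg[of x]
    by (simp add: sum_distrib_left abs_mult power_abs power_mult_distrib divide_inverse mult_ac)
  also have "(\<Sum>k<n. \<bar>r * ln (F x)\<bar> ^ k /\<^sub>R fact k) \<le> exp \<bar>r * ln (F x)\<bar>"
    unfolding exp_def by (intro sum_le_suminf summable_exp_generic) auto
  also have "F x * G x * exp \<bar>r * ln (F x)\<bar> \<le> (F x powr (1 + r) + F x powr (1 - r)) * G x"
    using mult_right_mono[OF exp_abs_ln_le[of x r] G_nonneg[of x]] by (simp add: mult_ac)
  finally show ?thesis
    using F_nonneg[of x] G_nonneg[of x] by (simp add: mult_left_mono)
qed

text \<open>A single term is at most a partial sum of the absolute series, and \<open>r = 1\<close>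
  leads to the exponents 2 and 0, both covered by \<open>integrable_powr_nonneg\<close>.\<close>

lemma integrable_coeff: "integrable M (\<lambda>x. F x * ln (F x) ^ k / fact k * G x)"
proof (rule Bochner_Integration.integrable_bound)
  show "integrable M (\<lambda>x. F x powr 2 * G x + F x powr 0 * G x)"
    by (intro Bochner_Integration.integrable_add integrable_powr_nonneg) auto
  have "norm (F x * ln (F x) ^ k / fact k * G x) \<le> norm (F x powr 2 * G x + F x powr 0 * G x)" for x
  proof -
    have "\<bar>F x * ln (F x) ^ k / fact k * G x\<bar>
        \<le> (\<Sum>j<Suc k. \<bar>F x * ln (F x) ^ j / fact j * G x\<bar> * 1 ^ j)"
      by (simp add: sum_nonneg)
    also have "\<dots> \<le> (F x powr (1 + 1) + F x powr (1 - 1)) * G x"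
      by (rule power_series_term_le) simp
    finally show ?thesis by (simp add: algebra_simps)
  qed
  then show "AE x in M. norm (F x * ln (F x) ^ k / fact k * G x) \<le> norm (F x powr 2 * G x + F x powr 0 * G x)"
    by simp
qed measurable

text \<open>Integrability at the exponent \<open>1 - r\<close> makes the majorant of
  \<open>power_series_term_le\<close> integrable, so sum and integral may be exchanged. For
  \<open>r > 1\<close> the disc reaches points \<open>1 + u\<close> with negative real part.\<close>

lemma mellin_sums:
  assumes "integrable M (\<lambda>x. F x powr (1 - r) * G x)" and u: "norm u \<le> r"
  shows "(\<lambda>k. complex_of_real (mellin_coeff k) * u ^ k) sums mellin (1 + u)"
proof -
  have "r \<ge> 0" using u norm_ge_zero[of u] by linarith
  define c where "c k x = F x * ln (F x) ^ k / fact k * G x" for k x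
  define f where "f k x = complex_of_real (c k x) * u ^ k" for k x
  define D where "D x = (F x powr (1 + r) + F x powr (1 - r)) * G x" for x
  have D_int: "integrable M D"
    unfolding D_def distrib_right using \<open>r \<ge> 0\<close>
    by (intro Bochner_Integration.integrable_add integrable_powr_nonneg assms(1)) auto
  have c_int: "integrable M (c k)" for k
    unfolding c_def by (rule integrable_coeff)
  have f_int: "integrable M (f k)" for k
    unfolding f_def using c_int by (intro integrable_mult_left integrable_of_real) auto
  have norm_f: "norm (f k x) \<le> \<bar>c k x\<bar> * r ^ k" for k x
    unfolding f_def using u by (simp add: norm_mult norm_power mult_left_mono power_mono)
  \<comment> \<open>This is the exponential series in u ln F; where \<open>F x = 0\<close> both
    sides are 0, since \<open>0 powr z = 0\<close>.\<close>
  have f_sums: "(\<lambda>k. f k x) sums (complex_of_real (F x) powr (1 + u) * complex_of_real (G x))" for x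
  proof (cases "F x = 0")
    case False
    then have pos: "F x > 0" using F_nonneg[of x] by linarith
    have "(\<lambda>k. (complex_of_real (F x) * complex_of_real (G x)) * ((u * of_real (ln (F x))) ^ k /\<^sub>R fact k))
        sums ((complex_of_real (F x) * complex_of_real (G x)) * exp (u * of_real (ln (F x))))"
      by (intro sums_mult exp_converges)
    moreover have "complex_of_real (F x) powr (1 + u) = complex_of_real (F x) * exp (u * of_real (ln (F x)))"
      using pos by (simp add: powr_add powr_def[of _ u] Ln_of_real)
    ultimately show ?thesis
      by (simp add: f_def c_def power_mult_distrib scaleR_conv_of_real divide_inverse mult_ac)
  qed (simp add: f_def c_def)
  have partial_le: "(\<Sum>k<n. norm (f k x)) \<le> D x" for n x
  proof -
    have "(\<Sum>k<n. norm (f k x)) \<le> (\<Sum>k<n. \<bar>c k x\<bar> * r ^ k)"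
      by (intro sum_mono norm_f)
    also have "\<dots> \<le> D x"
      unfolding c_def D_def by (rule power_series_term_le) fact
    finally show ?thesis .
  qed
  have "(\<lambda>k. integral\<^sup>L M (f k)) sums (\<integral>x. (\<Sum>k. f k x) \<partial>M)"
  proof (rule sums_integral)
    show "AE x in M. summable (\<lambda>k. norm (f k x))"
      using partial_le by (intro AE_I2 summableI_nonneg_bounded) auto
    show "summable (\<lambda>k. \<integral>x. norm (f k x) \<partial>M)"
    proof (rule summableI_nonneg_bounded)
      show "(\<Sum>k<n. \<integral>x. norm (f k x) \<partial>M) \<le> integral\<^sup>L M D" for n
      proof -
        have "(\<Sum>k<n. \<integral>x. norm (f k x) \<partial>M) = (\<integral>x. (\<Sum>k<n. norm (f k x)) \<partial>M)"
          using f_int by (intro Bochner_Integration.integral_sum[symmetric]) auto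
        also have "\<dots> \<le> integral\<^sup>L M D"
          using partial_le D_int f_int by (intro integral_mono) auto
        finally show ?thesis .
      qed
    qed simp
  qed (rule f_int)
  moreover have "integral\<^sup>L M (f k) = complex_of_real (mellin_coeff k) * u ^ k" for k
    unfolding f_def mellin_coeff_def c_def
    by (simp del: of_real_mult of_real_divide of_real_power)
  moreover have "(\<integral>x. (\<Sum>k. f k x) \<partial>M) = mellin (1 + u)"
    unfolding mellin_def using f_sums by (simp add: sums_iff)
  ultimately show ?thesis by simp
qed

text \<open>
  Landau's argument: the even terms of the power series are non-negative and sum up to
  \<open>F cosh (R ln F) G\<close>, which dominates \<open>F\<^bsup>1 - R\<^esup> G\<close>.
\<close>

lemma integrable_powr_of_summable_coeff:
  assumes "summable (\<lambda>k. norm (mellin_coeff k * R ^ k))"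
  shows "integrable M (\<lambda>x. F x powr (1 - R) * G x)"
proof -
  define e where "e k x = (if even k then F x * ln (F x) ^ k / fact k * G x * R ^ k else 0)" for k x
  have e_nonneg: "e k x \<ge> 0" for k x
    using F_nonneg[of x] G_nonneg[of x] by (auto simp: e_def)
  have e_int: "integrable M (e k)" for k
    unfolding e_def using integrable_mult_left[OF integrable_coeff[of k], of "R ^ k"]
    by (cases "even k") auto
  have e_sums: "(\<lambda>k. e k x) sums (F x * G x * cosh (R * ln (F x)))" for x
  proof -
    have "(\<lambda>k. F x * G x * (if even k then (R * ln (F x)) ^ k /\<^sub>R fact k else 0))
        sums (F x * G x * cosh (R * ln (F x)))"
      by (intro sums_mult cosh_converges)
    moreover have "F x * G x * (if even k then (R * ln (F x)) ^ k /\<^sub>R fact k else 0) = e k x" for k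
      by (simp add: e_def power_mult_distrib divide_inverse)
    ultimately show ?thesis by simp
  qed
  have "integrable M (\<lambda>x. \<Sum>k. e k x)"
  proof (rule integrable_suminf[OF e_int])
    show "AE x in M. summable (\<lambda>k. norm (e k x))"
      using e_sums e_nonneg by (auto simp: sums_iff)
    \<comment> \<open>Non-negativity is decisive here: the norm integrates to the coefficient
      itself, so convergence of the numerical series controls the integrals of absolute
      values.\<close>
    have "(\<integral>x. norm (e k x) \<partial>M) = (if even k then mellin_coeff k * R ^ k else 0)" for k
      using e_nonneg by (simp add: e_def mellin_coeff_def)
    then show "summable (\<lambda>k. \<integral>x. norm (e k x) \<partial>M)"
      by (intro summable_comparison_test'[OF assms, of 0]) auto
  qed
  then have int: "integrable M (\<lambda>x. 2 * (F x * G x * cosh (R * ln (F x))))"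
    using e_sums by (simp add: sums_iff)
  show ?thesis
  proof (rule Bochner_Integration.integrable_bound[OF int])
    have "F x powr (1 - R) * G x \<le> 2 * (F x * G x * cosh (R * ln (F x)))" for x
    proof -
      have "F x powr (1 - R) \<le> 2 * (F x * cosh (R * ln (F x)))"
        unfolding cosh_ln_eq by simp
      from mult_right_mono[OF this G_nonneg[of x]] show ?thesis by (simp add: mult_ac)
    qed
    then show "AE x in M. norm (F x powr (1 - R) * G x) \<le> norm (2 * (F x * G x * cosh (R * ln (F x))))"
      using F_nonneg G_nonneg by (intro AE_I2) (smt (verit) mult_nonneg_nonneg powr_ge_zero real_norm_def)
  qed measurable
qed

text \<open>\<open>F powr Re z\<close> is at most \<open>F powr 0\<close> where \<open>F\<close> is
  at most 1, and at most \<open>F powr A\<close> elsewhere. The bound is uniform on the closed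
  strip, including the imaginary axis.\<close>

lemma norm_mellin_le:
  assumes "0 \<le> Re z" "Re z \<le> A"
  shows "norm (mellin z) \<le> (\<integral>x. F x powr 0 * G x + F x powr A * G x \<partial>M)"
proof -
  have "norm (mellin z) \<le> (\<integral>x. norm (complex_of_real (F x) powr z * complex_of_real (G x)) \<partial>M)"
    unfolding mellin_def by (rule integral_norm_bound)
  also have "\<dots> = (\<integral>x. F x powr Re z * G x \<partial>M)"
    using F_nonneg G_nonneg by (simp add: norm_mult norm_powr_real_powr)
  also have "\<dots> \<le> (\<integral>x. F x powr 0 * G x + F x powr A * G x \<partial>M)"
  proof (rule integral_mono)
    show "F x powr Re z * G x \<le> F x powr 0 * G x + F x powr A * G x" for x
    proof -
      have "F x powr Re z \<le> F x powr 0 + F x powr A"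
      proof (cases "F x \<le> 1")
        case True
        then have "F x powr Re z \<le> F x powr 0"
          using assms F_nonneg[of x] by (cases "F x = 0") (auto intro!: powr_le1)
        then show ?thesis by (simp add: add_increasing2)
      next
        case False
        then have "F x powr Re z \<le> F x powr A"
          using assms by (intro powr_mono) auto
        then show ?thesis by (simp add: add_increasing)
      qed
      from mult_right_mono[OF this G_nonneg[of x]] show ?thesis by (simp add: distrib_right)
    qed
  qed (use assms in \<open>(intro integrable_powr_nonneg Bochner_Integration.integrable_add; simp)+\<close>)
  finally show ?thesis .
qed

lemma mellin_sums_disc:
  assumes "norm u < 1"
  shows "(\<lambda>k. complex_of_real (mellin_coeff k) * u ^ k) sums mellin (1 + u)"
  by (rule mellin_sums[where r = 1]) (use assms integrable_powr_nonneg[of 0] in auto)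

end

section \<open>Poles of a meromorphic continuation of the Mellin integral\<close>

locale mellin_continuation = mellin_pair +
  fixes \<zeta> :: "complex \<Rightarrow> complex"
  assumes meromorphic: "\<zeta> meromorphic_on UNIV"
    and eq_mellin: "\<And>z. Re z > 0 \<Longrightarrow> \<zeta> z = mellin z"
begin

definition mellin_fps :: "complex fps" where
  "mellin_fps = Abs_fps (\<lambda>k. complex_of_real (mellin_coeff k))"

text \<open>The unit disc around 1 lies in the half-plane where \<open>\<zeta>\<close> is the
  integral. This ties the Taylor coefficients of the continuation to integrals of powers of ln
  F.\<close>

lemma has_fps_expansion_continuation: "(\<lambda>u. \<zeta> (1 + u)) has_fps_expansion mellin_fps"
proof (rule has_fps_expansionI)
  have "eventually (\<lambda>u::complex. u \<in> ball 0 1) (nhds 0)"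
    by (intro eventually_nhds_in_open) auto
  then show "\<forall>\<^sub>F u in nhds 0. (\<lambda>n. fps_nth mellin_fps n * u ^ n) sums \<zeta> (1 + u)"
  proof eventually_elim
    case (elim u)
    then have "norm u < 1" by simp
    then have "Re (1 + u) > 0" using abs_Re_le_cmod[of u] by (simp add: abs_le_iff)
    then show ?case using mellin_sums_disc[OF \<open>norm u < 1\<close>] eq_mellin by (simp add: mellin_fps_def)
  qed
qed

text \<open>Approaching \<open>p\<close> from the right stays where \<open>\<zeta>\<close> is the
  integral and hence bounded, whereas near a pole the modulus is large in every direction. This also
  works for \<open>p = 0\<close>, on the edge of the half-plane.\<close>

lemma not_pole_nonneg:
  assumes "p \<ge> 0"
  shows "\<not> is_pole \<zeta> (complex_of_real p)"
proof
  assume "is_pole \<zeta> (complex_of_real p)"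
  then have inf: "filterlim \<zeta> at_infinity (at (complex_of_real p))"
    by (simp add: is_pole_def)
  define C where "C = (\<integral>x. F x powr 0 * G x + F x powr (p + 1) * G x \<partial>M)"
  have "C \<ge> 0" unfolding C_def using G_nonneg by (intro integral_nonneg_AE) auto
  with inf have "\<forall>\<^sub>F z in at (complex_of_real p). norm (\<zeta> z) \<ge> C + 1"
    by (subst (asm) filterlim_at_infinity[of 0]) auto
  then obtain d where d: "d > 0" "\<And>z. z \<noteq> of_real p \<Longrightarrow> dist z (of_real p) < d \<Longrightarrow> norm (\<zeta> z) \<ge> C + 1"
    unfolding eventually_at by auto
  \<comment> \<open>\<open>e < d\<close> keeps \<open>p + e\<close> close to the supposed pole, and
    \<open>e \<le> 1\<close> keeps it in the strip where the bound \<open>C\<close> holds.\<close>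
  define e where "e = min (d / 2) 1"
  have e: "0 < e" "e < d" "e \<le> 1" using d(1) by (auto simp: e_def)
  have "norm (\<zeta> (of_real (p + e))) \<ge> C + 1"
    using e by (intro d(2)) (auto simp: dist_norm)
  moreover have "norm (mellin (of_real (p + e))) \<le> C"
    unfolding C_def using e assms by (intro norm_mellin_le) auto
  moreover have "\<zeta> (of_real (p + e)) = mellin (of_real (p + e))"
    using e assms by (intro eq_mellin) auto
  ultimately show False by simp
qed

text \<open>The Taylor series at 1 has radius of convergence at least \<open>r\<close> and so
  defines an analytic function on that disc. It agrees with \<open>\<zeta>\<close> near 1, hence
  near \<open>p\<close> by the identity theorem for meromorphic functions.\<close>

lemma not_pole_of_integrable:
  assumes int: "integrable M (\<lambda>x. F x powr (1 - r) * G x)" and p: "norm (p - 1) < r"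
  shows "\<not> is_pole \<zeta> p"
proof -
  have r: "r > 0" using p norm_ge_zero[of "p - 1"] by linarith
  \<comment> \<open>Convergence at the single boundary point \<open>u = r\<close> already bounds the
    radius of convergence from below.\<close>
  have "summable (\<lambda>k. fps_nth mellin_fps k * complex_of_real r ^ k)"
    using mellin_sums[OF int, of "of_real r"] r by (simp add: mellin_fps_def sums_iff)
  then have conv: "ereal r \<le> fps_conv_radius mellin_fps"
    unfolding fps_conv_radius_def using conv_radius_geI r by fastforce
  define A where "A = ball (1::complex) r"
  define P where "P z = eval_fps mellin_fps (z - 1)" for z
  have P_an: "P analytic_on A"
    unfolding P_def A_def using conv
    by (intro analytic_on_eval_fps analytic_intros)
       (auto simp: dist_norm norm_minus_commute intro: less_le_trans[of "ereal _" "ereal r"])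
  have mero: "(\<lambda>z. \<zeta> z - P z) meromorphic_on A"
    using meromorphic_on_subset[OF meromorphic] analytic_on_imp_meromorphic_on[OF P_an]
    by (intro meromorphic_on_diff) auto
  have A: "open A" "connected A" "1 \<in> A" "p \<in> A"
    using p r by (auto simp: A_def dist_norm norm_minus_commute)
  have near1: "\<forall>\<^sub>F z in at 1. \<zeta> z - P z = 0"
  proof -
    have "\<forall>\<^sub>F u in nhds 0. eval_fps mellin_fps u = \<zeta> (1 + u)"
      using has_fps_expansion_continuation by (simp add: has_fps_expansion_def)
    then have "\<forall>\<^sub>F z in nhds (1::complex). eval_fps mellin_fps (z - 1) = \<zeta> (1 + (z - 1))"
      by (rule eventually_compose_filterlim) (auto intro!: tendsto_eq_intros filterlim_ident)
    then have "\<forall>\<^sub>F z in nhds 1. \<zeta> z - P z = 0"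
      by eventually_elim (simp add: P_def)
    then show ?thesis by (simp add: eventually_at_filter eventually_mono)
  qed
  \<comment> \<open>On a connected open set a meromorphic function is either zero off a sparse set
    or non-zero off a sparse set; the zeros accumulating at 1 exclude the latter.\<close>
  have "\<not> (\<forall>\<^sub>\<approx>z\<in>A. \<zeta> z - P z \<noteq> 0)"
  proof
    assume "\<forall>\<^sub>\<approx>z\<in>A. \<zeta> z - P z \<noteq> 0"
    then have "\<forall>\<^sub>F z in at 1. \<zeta> z - P z \<noteq> 0"
      using A by (simp add: eventually_cosparse_open_eq)
    with near1 have "\<forall>\<^sub>F z in at (1::complex). False"
      by eventually_elim simp
    then show False by simp
  qed
  with meromorphic_imp_constant_or_avoid[OF mero A(1,2), of 0]
  have "\<forall>\<^sub>\<approx>z\<in>A. \<zeta> z - P z = 0" by auto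
  then have "\<forall>\<^sub>F z in at p. \<zeta> z - P z = 0"
    using A by (simp add: eventually_cosparse_open_eq)
  then have "\<forall>\<^sub>F z in at p. \<zeta> z = P z" by simp
  then have "is_pole \<zeta> p \<longleftrightarrow> is_pole P p"
    by (intro is_pole_cong) auto
  moreover have "\<not> is_pole P p"
    using P_an A by (meson analytic_on_analytic_at analytic_at_imp_no_pole)
  ultimately show ?thesis by simp
qed

text \<open>Without poles in the disc only removable singularities remain. Once they are filled in,
  the function is holomorphic there, so the Taylor series converges absolutely at
  \<open>r < R\<close> and Landau's argument applies.\<close>

lemma integrable_of_no_pole:
  assumes no_pole: "\<And>p. norm (p - 1) < R \<Longrightarrow> \<not> is_pole \<zeta> p" and r: "0 \<le> r" "r < R"
  shows "integrable M (\<lambda>x. F x powr (1 - r) * G x)"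
proof -
  \<comment> \<open>A meromorphic function may have arbitrary values at isolated points, so the
    absence of poles alone does not make \<open>\<zeta>\<close> itself holomorphic.\<close>
  define h where "h = (\<lambda>u. remove_sings \<zeta> (1 + u))"
  have "remove_sings \<zeta> analytic_on ball 1 R"
    unfolding analytic_on_analytic_at[of _ "ball 1 R"]
  proof
    fix z :: complex assume "z \<in> ball 1 R"
    then have "\<not> is_pole \<zeta> z"
      by (intro no_pole) (simp add: dist_norm norm_minus_commute)
    moreover have "isolated_singularity_at \<zeta> z" "not_essential \<zeta> z"
      using meromorphic by (auto simp: meromorphic_on_altdef)
    ultimately obtain c where "\<zeta> \<midarrow>z\<rightarrow> c" "isolated_singularity_at \<zeta> z"
      unfolding not_essential_def by auto
    then show "remove_sings \<zeta> analytic_on {z}"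
      by (intro remove_sings_analytic_at)
  qed
  then have "h analytic_on ball 0 R"
    unfolding h_def
    by (rule analytic_on_compose_gen[where g = "remove_sings \<zeta>" and f = "\<lambda>u. 1 + u", unfolded o_def, rotated])
       (auto simp: dist_norm intro!: analytic_intros)
  then have hol: "h holomorphic_on eball 0 (ereal R)"
    by (auto intro: analytic_imp_holomorphic)
  have "h has_fps_expansion mellin_fps"
  proof -
    have "\<zeta> analytic_on {1}"
      using has_fps_expansion_continuation by (rule has_fps_expansion_imp_analytic)
    then have "\<forall>\<^sub>F z in nhds 1. remove_sings \<zeta> z = \<zeta> z"
      by (rule eventually_remove_sings_eq_nhds)
    then have "\<forall>\<^sub>F u in nhds 0. remove_sings \<zeta> (1 + u) = \<zeta> (1 + u)"
      by (rule eventually_compose_filterlim) (auto intro!: tendsto_eq_intros filterlim_ident)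
    then have "h has_fps_expansion mellin_fps \<longleftrightarrow> (\<lambda>u. \<zeta> (1 + u)) has_fps_expansion mellin_fps"
      unfolding h_def by (intro has_fps_expansion_cong) auto
    then show ?thesis using has_fps_expansion_continuation by simp
  qed
  then have conv: "fps_conv_radius mellin_fps \<ge> ereal R"
    using hol by (rule holomorphic_on_imp_fps_conv_radius_ge)
  have "summable (\<lambda>k. norm (fps_nth mellin_fps k * of_real r ^ k))"
    using r conv unfolding fps_conv_radius_def
    by (intro abs_summable_in_conv_radius) (auto intro: less_le_trans[of "ereal _" "ereal R"])
  then have "summable (\<lambda>k. norm (mellin_coeff k * r ^ k))"
    by (simp add: mellin_fps_def norm_mult norm_power abs_mult power_abs)
  then show ?thesis by (rule integrable_powr_of_summable_coeff)
qed

end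

subsection \<open>Integrals of monomials\<close>

text \<open>Tonelli's theorem for \<open>lborel\<close> is stated over \<open>Basis\<close>; the
  bijection from \<open>h\<close> to \<open>axis h 1\<close> turns it into a product over the index
  type.\<close>

lemma nn_integral_prod_vec:
  fixes f :: "'d::finite \<Rightarrow> real \<Rightarrow> real"
  assumes [measurable]: "\<And>h. f h \<in> borel_measurable borel" and "\<And>h x. f h x \<ge> 0"
  shows "(\<integral>\<^sup>+w. ennreal (\<Prod>h\<in>UNIV. f h (w $ h)) \<partial>(lborel :: (real ^ 'd) measure))
           = (\<Prod>h\<in>UNIV. \<integral>\<^sup>+x. ennreal (f h x) \<partial>lborel)"
proof -
  define ax where "ax h = (axis h 1 :: real ^ 'd)" for h
  define f' where "f' b = f (inv ax b)" for b
  have inj: "inj ax" by (auto simp: inj_on_def ax_def axis_eq_axis)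
  have Basis: "Basis = range ax" by (auto simp: Basis_vec_def ax_def)
  have "(\<integral>\<^sup>+w. ennreal (\<Prod>h\<in>UNIV. f h (w $ h)) \<partial>(lborel :: (real ^ 'd) measure))
      = (\<integral>\<^sup>+w. (\<Prod>b\<in>Basis. ennreal (f' b (w \<bullet> b))) \<partial>(lborel :: (real ^ 'd) measure))"
    using inj assms(2)
    by (simp add: Basis prod.reindex f'_def prod_ennreal o_def)
       (simp add: ax_def inner_axis)
  also have "\<dots> = (\<Prod>b\<in>Basis. \<integral>\<^sup>+x. ennreal (f' b x) \<partial>lborel)"
    by (rule nn_integral_lborel_prod) (auto simp: f'_def)
  also have "\<dots> = (\<Prod>h\<in>UNIV. \<integral>\<^sup>+x. ennreal (f h x) \<partial>lborel)"
    using inj by (simp add: Basis prod.reindex f'_def o_def)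
  finally show ?thesis .
qed

lemma nn_integral_powr_from_0:
  assumes "s > 0" "c \<ge> 0"
  shows "(\<integral>\<^sup>+x. ennreal (indicator {0..c} x * \<bar>x\<bar> powr (s - 1)) \<partial>lborel) = ennreal (c powr s / s)"
proof -
  have "((\<lambda>x. x powr (s - 1)) has_integral (c powr s / s)) {0..c}"
    using has_integral_powr_from_0[of "s - 1" c] assms by simp
  from nn_integral_has_integral_lebesgue[OF _ this]
  have "(\<integral>\<^sup>+x. ennreal (indicator {0..c} x * x powr (s - 1)) \<partial>lborel) = ennreal (c powr s / s)"
    by simp
  also have "(\<lambda>x. ennreal (indicator {0..c} x * x powr (s - 1))) = (\<lambda>x. ennreal (indicator {0..c} x * \<bar>x\<bar> powr (s - 1)))"
    by (auto simp: indicator_def)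
  finally show ?thesis .
qed

text \<open>The interval is split at 0 and the negative half reflected. The point 0 is counted
  twice, which is harmless for an upper bound.\<close>

lemma nn_integral_abs_powr:
  assumes "s > 0" "c \<ge> 0"
  shows "(\<integral>\<^sup>+x. ennreal (indicator {-c..c} x * \<bar>x\<bar> powr (s - 1)) \<partial>lborel) < \<infinity>"
proof -
  define p where "p x = ennreal (indicator {0..c} x * \<bar>x\<bar> powr (s - 1))" for x
  have [measurable]: "p \<in> borel_measurable borel" unfolding p_def by measurable
  have p: "(\<integral>\<^sup>+x. p x \<partial>lborel) = ennreal (c powr s / s)"
    unfolding p_def by (rule nn_integral_powr_from_0) fact+
  have "(\<integral>\<^sup>+x. p (- x) \<partial>lborel) = (\<integral>\<^sup>+x. p x \<partial>distr lborel borel uminus)"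
    by (subst nn_integral_distr) auto
  then have m: "(\<integral>\<^sup>+x. p (- x) \<partial>lborel) = ennreal (c powr s / s)"
    using p by (simp add: lborel_distr_uminus)
  have "(\<integral>\<^sup>+x. ennreal (indicator {-c..c} x * \<bar>x\<bar> powr (s - 1)) \<partial>lborel) \<le> (\<integral>\<^sup>+x. p x + p (- x) \<partial>lborel)"
    by (intro nn_integral_mono) (auto simp: p_def indicator_def)
  also have "\<dots> = (\<integral>\<^sup>+x. p x \<partial>lborel) + (\<integral>\<^sup>+x. p (- x) \<partial>lborel)"
    by (intro nn_integral_add) auto
  also have "\<dots> < \<infinity>" unfolding p m by simp
  finally show ?thesis .
qed

lemma abs_g_nonneg: "abs_g s w \<ge> 0"
  unfolding abs_g_def by (intro prod_nonneg) auto

lemma measurable_vec_nth [measurable]: "(\<lambda>w :: real ^ 'd::finite. w $ h) \<in> borel_measurable borel"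
  by (intro borel_measurable_continuous_onI continuous_intros)

lemma abs_g_measurable [measurable]: "abs_g s \<in> borel_measurable (borel :: (real ^ 'd::finite) measure)"
  unfolding abs_g_def by measurable

lemma sop_measurable [measurable]: "sop n a \<in> borel_measurable (borel :: (real ^ 'd::finite) measure)"
  unfolding sop_def by measurable

lemma indicator_cbox_eq_prod:
  fixes l u w :: "real ^ 'd::finite"
  shows "indicator (cbox l u) w = (\<Prod>h\<in>UNIV. indicator {l $ h..u $ h} (w $ h) :: real)"
proof (cases "w \<in> cbox l u")
  case False
  then obtain h where "w $ h \<notin> {l $ h..u $ h}" by (auto simp: mem_box_cart)
  then have "(\<Prod>h\<in>UNIV. indicator {l $ h..u $ h} (w $ h) :: real) = 0"
    by (intro prod_zero bexI[of _ h]) auto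
  then show ?thesis using False by simp
qed (auto simp: mem_box_cart)

lemma nn_integral_abs_g_cube:
  fixes s :: "'d::finite \<Rightarrow> real"
  assumes "\<And>h. s h > 0" "R \<ge> 0"
  shows "(\<integral>\<^sup>+w. ennreal (indicator (cbox (\<chi> h. - R) (\<chi> h. R)) w * abs_g s w) \<partial>(lborel :: (real ^ 'd) measure)) < \<infinity>"
proof -
  have "(\<integral>\<^sup>+w. ennreal (indicator (cbox (\<chi> h. - R) (\<chi> h. R)) w * abs_g s w) \<partial>(lborel :: (real ^ 'd) measure))
      = (\<integral>\<^sup>+w. ennreal (\<Prod>h\<in>UNIV. indicator {-R..R} (w $ h) * \<bar>w $ h\<bar> powr (s h - 1)) \<partial>(lborel :: (real ^ 'd) measure))"
    by (simp add: indicator_cbox_eq_prod abs_g_def prod.distrib)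
  also have "\<dots> = (\<Prod>h\<in>UNIV. \<integral>\<^sup>+x. ennreal (indicator {-R..R} x * \<bar>x\<bar> powr (s h - 1)) \<partial>lborel)"
    by (rule nn_integral_prod_vec) auto
  also have "\<dots> < \<infinity>"
    using nn_integral_abs_powr[OF assms(1) assms(2)]
    by (simp add: less_top[symmetric] ennreal_prod_eq_top)
  finally show ?thesis .
qed

lemma integrable_indicator_abs_g:
  fixes W :: "(real ^ 'd::finite) set"
  assumes "\<And>h. s h > 0" "compact W"
  shows "integrable lborel (\<lambda>w. indicator W w * abs_g s w)"
proof -
  have [measurable]: "W \<in> sets borel" using assms(2) by (simp add: borel_compact)
  obtain R where R: "\<And>w. w \<in> W \<Longrightarrow> norm w \<le> R" "R > 0"
    using compact_imp_bounded[OF assms(2)] by (auto simp: bounded_pos)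
  have sub: "W \<subseteq> cbox (\<chi> h. - R) (\<chi> h. R)"
  proof
    fix w assume "w \<in> W"
    then have "\<bar>w $ h\<bar> \<le> R" for h
      using R(1)[of w] component_le_norm_cart[of w h] by linarith
    then show "w \<in> cbox (\<chi> h. - R) (\<chi> h. R)"
      by (auto simp: mem_box_cart abs_le_iff minus_le_iff)
  qed
  have "(\<integral>\<^sup>+w. ennreal (norm (indicator W w * abs_g s w)) \<partial>lborel)
      \<le> (\<integral>\<^sup>+w. ennreal (indicator (cbox (\<chi> h. - R) (\<chi> h. R)) w * abs_g s w) \<partial>lborel)"
    using sub by (intro nn_integral_mono ennreal_leI) (auto simp: indicator_def abs_g_nonneg)
  also have "\<dots> < \<infinity>" using R assms(1) by (intro nn_integral_abs_g_cube) auto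
  finally show ?thesis by (intro integrableI_bounded) auto
qed

text \<open>Unlike for the cube, the exact value matters: the divergence proof depends on how the
  mass scales with \<open>u\<close>.\<close>

lemma nn_integral_abs_g_box:
  fixes s :: "'d::finite \<Rightarrow> real" and u :: "real ^ 'd"
  assumes "\<And>h. s h > 0" "\<And>h. u $ h \<ge> 0"
  shows "(\<integral>\<^sup>+w. ennreal (indicator (cbox 0 u) w * abs_g s w) \<partial>lborel)
           = ennreal (\<Prod>h\<in>UNIV. (u $ h) powr s h / s h)"
proof -
  have "(\<integral>\<^sup>+w. ennreal (indicator (cbox 0 u) w * abs_g s w) \<partial>lborel)
      = (\<integral>\<^sup>+w. ennreal (\<Prod>h\<in>UNIV. indicator {0..u $ h} (w $ h) * \<bar>w $ h\<bar> powr (s h - 1)) \<partial>(lborel :: (real ^ 'd) measure))"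
    by (simp add: indicator_cbox_eq_prod abs_g_def prod.distrib)
  also have "\<dots> = (\<Prod>h\<in>UNIV. \<integral>\<^sup>+x. ennreal (indicator {0..u $ h} x * \<bar>x\<bar> powr (s h - 1)) \<partial>lborel)"
    by (rule nn_integral_prod_vec) auto
  also have "\<dots> = ennreal (\<Prod>h\<in>UNIV. (u $ h) powr s h / s h)"
    using assms by (simp add: nn_integral_powr_from_0 less_imp_le prod_ennreal)
  finally show ?thesis .
qed

subsection \<open>The max-min value\<close>

definition simplex_min :: "nat \<Rightarrow> ('d::finite \<Rightarrow> nat \<Rightarrow> nat) \<Rightarrow> ('d \<Rightarrow> real) \<Rightarrow> real ^ 'd \<Rightarrow> real" where
  "simplex_min n a s \<alpha> = (MIN j\<in>{1..n}. \<Sum>h\<in>UNIV. \<alpha> $ h * (real (a h j) / s h))"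

lemma prob_simplex_nonneg: "\<alpha> \<in> prob_simplex \<Longrightarrow> \<alpha> $ h \<ge> 0"
  by (simp add: prob_simplex_def)

lemma prob_simplex_sum: "\<alpha> \<in> prob_simplex \<Longrightarrow> (\<Sum>h\<in>UNIV. \<alpha> $ h) = 1"
  by (simp add: prob_simplex_def)

lemma axis_in_prob_simplex: "axis h 1 \<in> prob_simplex"
  by (auto simp: prob_simplex_def axis_def if_distrib cong: if_cong)

text \<open>The supremum in \<open>maxmin\<close> is taken in the reals, so its bounds can be used
  only once boundedness is known; every coordinate of \<open>\<alpha>\<close> is at most 1.\<close>

lemma bdd_above_simplex_min:
  fixes a :: "'d::finite \<Rightarrow> nat \<Rightarrow> nat"
  assumes "n \<ge> 1" "\<And>h. s h > 0"
  shows "bdd_above (simplex_min n a s ` prob_simplex)"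
proof (rule bdd_aboveI2)
  fix \<alpha> :: "real ^ 'd" assume \<alpha>: "\<alpha> \<in> prob_simplex"
  have "\<alpha> $ h \<le> 1" for h
    using prob_simplex_sum[OF \<alpha>] prob_simplex_nonneg[OF \<alpha>] member_le_sum[of h UNIV "\<lambda>h. \<alpha> $ h"] by simp
  have "simplex_min n a s \<alpha> \<le> (\<Sum>h\<in>UNIV. \<alpha> $ h * (real (a h 1) / s h))"
    unfolding simplex_min_def using assms by (intro Min_le) auto
  also have "\<dots> \<le> (\<Sum>h\<in>UNIV. 1 * (real (a h 1) / s h))"
    using \<open>\<And>h. \<alpha> $ h \<le> 1\<close> assms by (intro sum_mono mult_right_mono) (auto intro: divide_nonneg_pos)
  finally show "simplex_min n a s \<alpha> \<le> (\<Sum>h\<in>UNIV. 1 * (real (a h 1) / s h))" .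
qed

lemma simplex_min_le_maxmin:
  assumes "n \<ge> 1" "\<And>h. s h > 0" "\<alpha> \<in> prob_simplex"
  shows "simplex_min n a s \<alpha> \<le> maxmin n a s"
  unfolding maxmin_def simplex_min_def[symmetric]
  using assms by (intro cSUP_upper bdd_above_simplex_min)

lemma less_maxmin_ex:
  assumes "n \<ge> 1" "\<And>h. s h > 0" "c < maxmin n a s"
  obtains \<alpha> where "\<alpha> \<in> prob_simplex" "c < simplex_min n a s \<alpha>"
proof -
  have "\<exists>\<alpha>\<in>prob_simplex. c < simplex_min n a s \<alpha>"
    using assms(3) unfolding maxmin_def simplex_min_def[symmetric]
    by (subst (asm) less_cSUP_iff)
       (use axis_in_prob_simplex bdd_above_simplex_min[OF assms(1,2)] in auto)
  then show ?thesis using that by blast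
qed

lemma maxmin_le:
  assumes "\<And>\<alpha>. \<alpha> \<in> prob_simplex \<Longrightarrow> simplex_min n a s \<alpha> \<le> c"
  shows "maxmin n a s \<le> c"
  unfolding maxmin_def simplex_min_def[symmetric]
  using assms axis_in_prob_simplex by (intro cSUP_least) auto

lemma maxmin_nonneg:
  fixes a :: "'d::finite \<Rightarrow> nat \<Rightarrow> nat"
  assumes "n \<ge> 1" "\<And>h. s h > 0"
  shows "maxmin n a s \<ge> 0"
proof -
  have "0 \<le> simplex_min n a s (axis (undefined :: 'd) 1)"
    unfolding simplex_min_def using assms prob_simplex_nonneg[OF axis_in_prob_simplex]
    by (intro Min.boundedI) (auto intro!: sum_nonneg mult_nonneg_nonneg divide_nonneg_pos)
  also have "\<dots> \<le> maxmin n a s"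
    using assms by (intro simplex_min_le_maxmin axis_in_prob_simplex)
  finally show ?thesis .
qed

text \<open>Dividing \<open>y\<close> by its sum gives a point of the simplex, where the minimum is
  attained by some term. This homogeneous form will be applied to negative logarithms of the
  coordinates.\<close>

lemma exists_term_le_maxmin:
  fixes a :: "'d::finite \<Rightarrow> nat \<Rightarrow> nat"
  assumes "n \<ge> 1" "\<And>h. s h > 0" "\<And>h. y h \<ge> 0"
  shows "\<exists>j\<in>{1..n}. (\<Sum>h\<in>UNIV. y h * (real (a h j) / s h)) \<le> maxmin n a s * (\<Sum>h\<in>UNIV. y h)"
proof (cases "(\<Sum>h\<in>UNIV. y h) = 0")
  case True
  then have "y h = 0" for h using assms(3) by (simp add: sum_nonneg_eq_0_iff)
  then show ?thesis using assms(1) by auto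
next
  case False
  define Y where "Y = (\<Sum>h\<in>UNIV. y h)"
  have Y: "Y > 0" using False assms(3) sum_nonneg[of UNIV y] unfolding Y_def by force
  define \<alpha> :: "real ^ 'd" where "\<alpha> = (\<chi> h. y h / Y)"
  have "\<alpha> \<in> prob_simplex"
    using Y assms(3) by (auto simp: prob_simplex_def \<alpha>_def sum_divide_distrib[symmetric] Y_def[symmetric])
  then have le: "simplex_min n a s \<alpha> \<le> maxmin n a s"
    using assms by (intro simplex_min_le_maxmin)
  have "simplex_min n a s \<alpha> \<in> (\<lambda>j. \<Sum>h\<in>UNIV. \<alpha> $ h * (real (a h j) / s h)) ` {1..n}"
    unfolding simplex_min_def using assms(1) by (intro Min_in) auto
  then obtain j where j: "j \<in> {1..n}" "(\<Sum>h\<in>UNIV. \<alpha> $ h * (real (a h j) / s h)) \<le> maxmin n a s"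
    using le by auto
  have "(\<Sum>h\<in>UNIV. \<alpha> $ h * (real (a h j) / s h)) = (\<Sum>h\<in>UNIV. y h * (real (a h j) / s h)) / Y"
    by (simp add: \<alpha>_def sum_divide_distrib mult.commute)
  with j(2) Y have "(\<Sum>h\<in>UNIV. y h * (real (a h j) / s h)) \<le> maxmin n a s * Y"
    by (simp only: pos_divide_le_eq)
  with j(1) show ?thesis by (auto simp: Y_def)
qed

section \<open>The closed formula for two terms\<close>

lemma simplex_min_2:
  "simplex_min 2 a s \<alpha> = min (\<Sum>h\<in>UNIV. \<alpha> $ h * (real (a h 1) / s h)) (\<Sum>h\<in>UNIV. \<alpha> $ h * (real (a h 2) / s h))"
proof -
  have "{1..2::nat} = {1, 2}" by auto
  then show ?thesis by (simp add: simplex_min_def)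
qed

text \<open>
  Linear programming duality in dimension one. Only the coordinates with \<open>x h > 0\<close> or \<open>y h > 0\<close>
  matter; if both sums were positive, multiplying the two inequalities would contradict the sum of
  the conditions \<open>x h * y h' \<le> y h * x h'\<close>.
\<close>

lemma two_forms_nonpos:
  fixes x y \<alpha> :: "'d::finite \<Rightarrow> real"
  assumes \<alpha>: "\<And>h. \<alpha> h \<ge> 0"
    and min: "\<And>h. x h \<le> 0 \<or> y h \<le> 0"
    and cross: "\<And>h h'. x h > 0 \<Longrightarrow> y h' > 0 \<Longrightarrow> x h * y h' \<le> y h * x h'"
  shows "(\<Sum>h\<in>UNIV. \<alpha> h * x h) \<le> 0 \<or> (\<Sum>h\<in>UNIV. \<alpha> h * y h) \<le> 0"
proof (rule ccontr)
  assume "\<not> ?thesis"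
  then have pos: "(\<Sum>h\<in>UNIV. \<alpha> h * x h) > 0" "(\<Sum>h\<in>UNIV. \<alpha> h * y h) > 0" by auto
  define A where "A = {h. x h > 0}"
  define B where "B = {h. y h > 0}"
  have disj: "A \<inter> B = {}" using min by (fastforce simp: A_def B_def not_le[symmetric])
  have "(\<Sum>h\<in>UNIV. \<alpha> h * x h) \<le> (\<Sum>h\<in>A \<union> B. \<alpha> h * x h)"
    using sum.subset_diff[of "A \<union> B" UNIV "\<lambda>h. \<alpha> h * x h"]
      sum_nonpos[of "UNIV - (A \<union> B)" "\<lambda>h. \<alpha> h * x h"] \<alpha>
    by (auto simp: A_def mult_nonneg_nonpos)
  then have xA: "(\<Sum>h\<in>A. \<alpha> h * x h) > (\<Sum>h\<in>B. \<alpha> h * (- x h))"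
    using pos(1) disj by (simp add: sum.union_disjoint sum_negf)
  have "(\<Sum>h\<in>UNIV. \<alpha> h * y h) \<le> (\<Sum>h\<in>A \<union> B. \<alpha> h * y h)"
    using sum.subset_diff[of "A \<union> B" UNIV "\<lambda>h. \<alpha> h * y h"]
      sum_nonpos[of "UNIV - (A \<union> B)" "\<lambda>h. \<alpha> h * y h"] \<alpha>
    by (auto simp: B_def mult_nonneg_nonpos)
  then have yB: "(\<Sum>h\<in>B. \<alpha> h * y h) > (\<Sum>h\<in>A. \<alpha> h * (- y h))"
    using pos(2) disj by (simp add: sum.union_disjoint sum_negf)
  have nonneg: "(\<Sum>h\<in>B. \<alpha> h * (- x h)) \<ge> 0" "(\<Sum>h\<in>A. \<alpha> h * (- y h)) \<ge> 0"
    using \<alpha> disj by (intro sum_nonneg mult_nonneg_nonneg; force simp: A_def B_def not_less)+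
  have "(\<Sum>h\<in>B. \<alpha> h * (- x h)) * (\<Sum>h\<in>A. \<alpha> h * (- y h)) < (\<Sum>h\<in>A. \<alpha> h * x h) * (\<Sum>h\<in>B. \<alpha> h * y h)"
    using xA yB nonneg by (intro mult_strict_mono) auto
  moreover have "(\<Sum>h\<in>A. \<alpha> h * x h) * (\<Sum>h\<in>B. \<alpha> h * y h)
      \<le> (\<Sum>h\<in>A. \<alpha> h * (- y h)) * (\<Sum>h\<in>B. \<alpha> h * (- x h))"
    unfolding sum_product
  proof (intro sum_mono)
    fix h h' assume "h \<in> A" "h' \<in> B"
    then have "x h * y h' \<le> y h * x h'" by (intro cross) (auto simp: A_def B_def)
    then have "\<alpha> h * \<alpha> h' * (x h * y h') \<le> \<alpha> h * \<alpha> h' * (y h * x h')"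
      using \<alpha> by (intro mult_left_mono) auto
    then show "\<alpha> h * x h * (\<alpha> h' * y h') \<le> \<alpha> h * - y h * (\<alpha> h' * - x h')"
      by (simp add: mult_ac)
  qed
  ultimately show False by (simp add: mult.commute)
qed

definition crossing_value :: "('d \<Rightarrow> nat \<Rightarrow> nat) \<Rightarrow> ('d \<Rightarrow> real) \<Rightarrow> 'd \<Rightarrow> 'd \<Rightarrow> real" where
  "crossing_value a s h h' =
     (\<nu> a s h * \<nu> a s h' - \<mu> a s h * \<mu> a s h') / (\<nu> a s h + \<nu> a s h' - \<mu> a s h - \<mu> a s h')"

lemma two_term_value_eq:
  "two_term_value a s = Max (range (\<mu> a s) \<union> (\<lambda>(h, h'). crossing_value a s h h') ` H_pairs a s)"
  by (simp add: two_term_value_def crossing_value_def)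

text \<open>Since \<open>\<alpha>\<close> sums to 1, subtracting \<open>T\<close> from all entries
  reduces the claim to the sign of two linear forms. The bounds on \<open>\<mu>\<close> and on the
  crossing values are then the two conditions of \<open>two_forms_nonpos\<close>.\<close>

lemma maxmin_le_two_term_value:
  fixes a :: "'d::finite \<Rightarrow> nat \<Rightarrow> nat"
  assumes s: "\<And>h. s h > 0"
  shows "maxmin 2 a s \<le> two_term_value a s"
proof (rule maxmin_le)
  fix \<alpha> :: "real ^ 'd" assume \<alpha>: "\<alpha> \<in> prob_simplex"
  define T where "T = two_term_value a s"
  define x where "x h = real (a h 1) / s h - T" for h
  define y where "y h = real (a h 2) / s h - T" for h
  have \<mu>_le: "\<mu> a s h \<le> T" for h
    unfolding T_def two_term_value_eq by (intro Max_ge) auto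
  have cross_le: "crossing_value a s h h' \<le> T" if "(h, h') \<in> H_pairs a s" for h h'
    unfolding T_def two_term_value_eq using that by (intro Max_ge) force+
  have "(\<Sum>h\<in>UNIV. \<alpha> $ h * x h) \<le> 0 \<or> (\<Sum>h\<in>UNIV. \<alpha> $ h * y h) \<le> 0"
  proof (rule two_forms_nonpos)
    show "\<alpha> $ h \<ge> 0" for h using \<alpha> by (rule prob_simplex_nonneg)
    show "x h \<le> 0 \<or> y h \<le> 0" for h
      using \<mu>_le[of h] by (auto simp: x_def y_def \<mu>_def min_def split: if_splits)
    show "x h * y h' \<le> y h * x h'" if h: "x h > 0" and h': "y h' > 0" for h h'
    proof -
      \<comment> \<open>Each coordinate has at most one positive entry, so the terms are ordered
        oppositely in \<open>h\<close> and \<open>h'\<close>, as \<open>H_pairs\<close>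
        demands.\<close>
      have "y h \<le> 0" "x h' \<le> 0" using \<open>\<And>h. x h \<le> 0 \<or> y h \<le> 0\<close> h h' by (force simp: not_le[symmetric])+
      then have "real (a h 2) / s h < real (a h 1) / s h" "real (a h' 1) / s h' < real (a h' 2) / s h'"
        using h h' by (auto simp: x_def y_def)
      then have lt: "a h 2 < a h 1" "a h' 1 < a h' 2"
        using s[of h] s[of h'] by (auto simp: divide_less_cancel)
      have eqs: "\<nu> a s h = x h + T" "\<mu> a s h = y h + T" "\<nu> a s h' = y h' + T" "\<mu> a s h' = x h' + T"
        using lt by (auto simp: \<nu>_def \<mu>_def x_def y_def max_def min_def)
      have D: "\<nu> a s h + \<nu> a s h' - \<mu> a s h - \<mu> a s h' > 0"
        unfolding eqs using h h' \<open>y h \<le> 0\<close> \<open>x h' \<le> 0\<close> by simp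
      have "(h, h') \<in> H_pairs a s"
        unfolding H_pairs_def using lt h h' \<open>y h \<le> 0\<close> \<open>x h' \<le> 0\<close> by (auto simp: eqs)
      from cross_le[OF this] D
      have "\<nu> a s h * \<nu> a s h' - \<mu> a s h * \<mu> a s h' \<le> T * (\<nu> a s h + \<nu> a s h' - \<mu> a s h - \<mu> a s h')"
        by (simp add: crossing_value_def divide_le_eq)
      \<comment> \<open>With the denominator cleared, all terms containing \<open>T\<close> cancel
        and the cross condition remains.\<close>
      then show ?thesis unfolding eqs by (simp add: algebra_simps)
    qed
  qed
  moreover have "(\<Sum>h\<in>UNIV. \<alpha> $ h * T) = T"
    using prob_simplex_sum[OF \<alpha>] by (simp add: sum_distrib_right[symmetric])
  ultimately show "simplex_min 2 a s \<alpha> \<le> two_term_value a s"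
    by (auto simp: simplex_min_2 x_def y_def right_diff_distrib sum_subtractf T_def min_le_iff_disj)
qed

text \<open>The crossing value is attained as the minimum at a point on the edge between two
  vertices of the simplex, so it cannot exceed the maximum.\<close>

lemma crossing_value_le_maxmin:
  fixes a :: "'d::finite \<Rightarrow> nat \<Rightarrow> nat"
  assumes s: "\<And>h. s h > 0" and lt: "a h 2 < a h 1" "a h' 1 < a h' 2"
  shows "crossing_value a s h h' \<le> maxmin 2 a s"
proof -
  define p q p' q' where "p = real (a h 1) / s h" and "q = real (a h 2) / s h"
    and "p' = real (a h' 1) / s h'" and "q' = real (a h' 2) / s h'"
  have less: "q < p" "p' < q'"
    unfolding p_def q_def p'_def q'_def using lt s by (intro divide_strict_right_mono; simp)+
  define D where "D = p + q' - q - p'"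
  have D: "D > 0" using less by (simp add: D_def)
  have "h \<noteq> h'" using lt by auto
  \<comment> \<open>The weights solve
    \<open>\<alpha> $ h * (p - q) = \<alpha> $ h' * (q' - p')\<close> with sum 1, which makes both
    linear forms equal.\<close>
  define \<alpha> :: "real ^ 'd" where "\<alpha> = (\<chi> k. if k = h then (q' - p') / D else if k = h' then (p - q) / D else 0)"
  have sum_\<alpha>: "(\<Sum>k\<in>UNIV. \<alpha> $ k * f k) = ((q' - p') * f h + (p - q) * f h') / D" for f
  proof -
    have "(\<Sum>k\<in>UNIV. \<alpha> $ k * f k) = (\<Sum>k\<in>{h, h'}. \<alpha> $ k * f k)"
      by (intro sum.mono_neutral_right) (auto simp: \<alpha>_def)
    then show ?thesis using \<open>h \<noteq> h'\<close> by (simp add: \<alpha>_def add_divide_distrib)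
  qed
  have "\<alpha> \<in> prob_simplex"
    using sum_\<alpha>[of "\<lambda>_. 1"] D less by (auto simp: prob_simplex_def \<alpha>_def D_def)
  then have "simplex_min 2 a s \<alpha> \<le> maxmin 2 a s"
    using s by (intro simplex_min_le_maxmin) auto
  moreover have "crossing_value a s h h' = (p * q' - q * p') / D"
    using lt by (simp add: crossing_value_def \<nu>_def \<mu>_def max_def min_def p_def q_def p'_def q'_def D_def)
  moreover have "simplex_min 2 a s \<alpha> = (p * q' - q * p') / D"
  proof -
    have "(q' - p') * p + (p - q) * p' = p * q' - q * p'" "(q' - p') * q + (p - q) * q' = p * q' - q * p'"
      by (simp_all add: algebra_simps)
    then show ?thesis
      unfolding simplex_min_2 sum_\<alpha> p_def[symmetric] q_def[symmetric] p'_def[symmetric] q'_def[symmetric]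
      by simp
  qed
  ultimately show ?thesis by simp
qed

text \<open>The values of \<open>\<mu>\<close> come from the vertices of the simplex, the crossing
  values from its edges. Symmetry in \<open>h\<close> and \<open>h'\<close> lets the first term be
  the larger one in either variable.\<close>

lemma two_term_value_le_maxmin:
  fixes a :: "'d::finite \<Rightarrow> nat \<Rightarrow> nat"
  assumes s: "\<And>h. s h > 0"
  shows "two_term_value a s \<le> maxmin 2 a s"
  unfolding two_term_value_eq
proof (rule Max.boundedI)
  fix v assume "v \<in> range (\<mu> a s) \<union> (\<lambda>(h, h'). crossing_value a s h h') ` H_pairs a s"
  then consider h where "v = \<mu> a s h" | h h' where "v = crossing_value a s h h'" "(h, h') \<in> H_pairs a s"
    by auto
  then show "v \<le> maxmin 2 a s"
  proof cases
    case (1 h)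
    have "(\<Sum>k\<in>UNIV. axis h 1 $ k * (real (a k j) / s k)) = real (a h j) / s h" for j
      by (subst sum.mono_neutral_right[of UNIV "{h}"]) (auto simp: axis_def)
    then have "simplex_min 2 a s (axis h 1) = v"
      using s[of h] 1 by (simp add: simplex_min_2 \<mu>_def min_def divide_le_cancel)
    then show ?thesis
      using simplex_min_le_maxmin[where n = 2 and a = a and s = s, OF _ s axis_in_prob_simplex[of h]] by simp
  next
    case (2 h h')
    then have "a h 1 \<noteq> a h 2" "a h' 1 \<noteq> a h' 2" "(a h 1 < a h 2) \<noteq> (a h' 1 < a h' 2)"
      by (auto simp: H_pairs_def \<nu>_def \<mu>_def)
    then consider "a h 2 < a h 1" "a h' 1 < a h' 2" | "a h' 2 < a h' 1" "a h 1 < a h 2"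
      by linarith
    moreover have "crossing_value a s h h' = crossing_value a s h' h"
      by (simp add: crossing_value_def algebra_simps)
    ultimately show ?thesis
      using 2(1) crossing_value_le_maxmin[where a = a and s = s and h = h and h' = h', OF s]
        crossing_value_le_maxmin[where a = a and s = s and h = h' and h' = h, OF s] by cases auto
  qed
qed auto

lemma maxmin_2_eq_two_term_value:
  assumes "\<And>h. s h > 0"
  shows "maxmin 2 a s = two_term_value a s"
  using maxmin_le_two_term_value[OF assms] two_term_value_le_maxmin[OF assms] by (rule antisym)

subsection \<open>Convergence and divergence of the zeta integral\<close>

lemma sop_nonneg: "nonneg_sop n a \<Longrightarrow> sop n a w \<ge> 0"
  by (simp add: nonneg_sop_def)

lemma continuous_on_sop: "continuous_on S (sop n a)"
  unfolding sop_def by (intro continuous_intros)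

text \<open>The indicator of \<open>W\<close> goes into the weight, so that \<open>F\<close> is the
  polynomial itself. It is bounded on \<open>W\<close>, which gives integrability for all exponents
  \<open>\<sigma> \<ge> 0\<close>.\<close>

lemma mellin_continuation_sop:
  fixes a :: "'d::finite \<Rightarrow> nat \<Rightarrow> nat"
  assumes sop: "nonneg_sop n a" and s: "\<And>h. s h > 0" and W: "compact W"
    and \<zeta>: "zeta_continuation n a s W \<zeta>"
  shows "mellin_continuation lborel (sop n a) (\<lambda>w. indicator W w * abs_g s w) \<zeta>"
proof -
  have [measurable]: "W \<in> sets borel" using W by (simp add: borel_compact)
  have pair: "mellin_pair lborel (sop n a) (\<lambda>w. indicator W w * abs_g s w)"
  proof
    show "integrable lborel (\<lambda>w. sop n a w powr \<sigma> * (indicator W w * abs_g s w))" if \<sigma>: "\<sigma> \<ge> 0" for \<sigma>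
    proof -
      obtain B where B: "\<And>w. w \<in> W \<Longrightarrow> sop n a w \<le> B"
        using compact_imp_bounded[OF compact_continuous_image[OF continuous_on_sop W, of n a]]
        by (fastforce simp: bounded_iff abs_le_iff)
      show ?thesis
      proof (rule Bochner_Integration.integrable_bound)
        show "integrable lborel (\<lambda>w. B powr \<sigma> * (indicator W w * abs_g s w))"
          using s W by (intro integrable_mult_right integrable_indicator_abs_g)
        show "AE w in lborel. norm (sop n a w powr \<sigma> * (indicator W w * abs_g s w))
                \<le> norm (B powr \<sigma> * (indicator W w * abs_g s w))"
          using B \<sigma> sop_nonneg[OF sop] abs_g_nonneg
          by (intro AE_I2) (auto simp: abs_mult indicator_def intro!: mult_right_mono powr_mono2)
      qed measurable
    qed
  qed (use sop in \<open>auto simp: sop_nonneg abs_g_nonneg\<close>)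
  interpret mellin_pair lborel "sop n a" "\<lambda>w. indicator W w * abs_g s w"
    by (rule pair)
  show ?thesis
  proof
    show "\<zeta> meromorphic_on UNIV" using \<zeta> by (simp add: zeta_continuation_def)
    show "\<zeta> z = mellin z" if "Re z > 0" for z
    proof -
      have "zeta_integral n a s W z = mellin z"
        unfolding zeta_integral_def mellin_def set_lebesgue_integral_def
        by (intro Bochner_Integration.integral_cong) (auto simp: indicator_def)
      then show ?thesis using \<zeta> that by (simp add: zeta_continuation_def)
    qed
  qed
qed

text \<open>At the corner of the box, the monomial \<open>j\<close> equals \<open>t\<close> to the
  power of its linear form at \<open>\<alpha>\<close>; as \<open>t \<le> 1\<close>, the smallest
  exponent gives the largest value.\<close>

lemma sop_le_on_box:
  fixes w :: "real ^ 'd::finite"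
  assumes t: "0 < t" "t \<le> 1" and m: "m \<le> simplex_min n a s \<alpha>"
    and w: "\<And>h. 0 \<le> w $ h \<and> w $ h \<le> t powr (\<alpha> $ h / s h)"
  shows "sop n a w \<le> real n * t powr m"
proof -
  have "(\<Prod>h\<in>UNIV. (w $ h) ^ a h j) \<le> t powr m" if j: "j \<in> {1..n}" for j
  proof -
    have "(\<Prod>h\<in>UNIV. (w $ h) ^ a h j) \<le> (\<Prod>h\<in>UNIV. (t powr (\<alpha> $ h / s h)) ^ a h j)"
      using w by (intro prod_mono) (auto intro: power_mono)
    also have "\<dots> = (\<Prod>h\<in>UNIV. t powr (\<alpha> $ h * (real (a h j) / s h)))"
      using t by (simp add: powr_realpow[symmetric] powr_powr)
    also have "\<dots> = t powr (\<Sum>h\<in>UNIV. \<alpha> $ h * (real (a h j) / s h))"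
      using t by (simp add: powr_sum)
    also have "\<dots> \<le> t powr m"
    proof (rule powr_mono')
      have "simplex_min n a s \<alpha> \<le> (\<Sum>h\<in>UNIV. \<alpha> $ h * (real (a h j) / s h))"
        unfolding simplex_min_def using j by (intro Min_le) auto
      then show "m \<le> (\<Sum>h\<in>UNIV. \<alpha> $ h * (real (a h j) / s h))" using m by simp
    qed (use t in auto)
    finally show ?thesis .
  qed
  then have "sop n a w \<le> (\<Sum>j=1..n. t powr m)"
    unfolding sop_def by (intro sum_mono)
  then show ?thesis by simp
qed

lemma not_integrable_neg_powr:
  fixes a :: "'d::finite \<Rightarrow> nat \<Rightarrow> nat"
  assumes n: "n \<ge> 1" and s: "\<And>h. s h > 0" and W: "compact W" "cbox 0 (\<chi> h. 1) \<subseteq> W"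
    and \<alpha>: "\<alpha> \<in> prob_simplex" and m: "m \<le> simplex_min n a s \<alpha>" and x: "x > 0" "m * x > 1"
  shows "\<not> integrable lborel (\<lambda>w. sop n a w powr (- x) * (indicator W w * abs_g s w))"
proof
  assume int: "integrable lborel (\<lambda>w. sop n a w powr (- x) * (indicator W w * abs_g s w))"
  define I where "I = (LINT w|lborel. sop n a w powr (- x) * (indicator W w * abs_g s w))"
  define P where "P = (\<Prod>h\<in>UNIV. s h)"
  \<comment> \<open>\<open>1 / P\<close> comes from the mass of the box and
    \<open>real n powr (- x)\<close> from the bound n t^m on the polynomial.\<close>
  define C where "C = real n powr (- x) / P"
  have P: "P > 0" unfolding P_def using s by (intro prod_pos) auto
  have C: "C > 0" unfolding C_def using n P by simp
  have lower: "C * t powr (1 - m * x) \<le> I" if t: "0 < t" "t \<le> 1" for t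
  proof -
    define u :: "real ^ 'd" where "u = (\<chi> h. t powr (\<alpha> $ h / s h))"
    define k where "k = (real n * t powr m) powr (- x)"
    have u01: "0 \<le> u $ h" "u $ h \<le> 1" for h
      using t prob_simplex_nonneg[OF \<alpha>, of h] s[of h] by (auto simp: u_def intro!: powr_le1 divide_nonneg_pos)
    have sub: "cbox 0 u \<subseteq> W"
    proof -
      have "cbox 0 u \<subseteq> cbox 0 (\<chi> h. 1)"
        using u01(2) by (simp add: subset_iff mem_box_cart) (meson order_trans)
      then show ?thesis using W(2) by simp
    qed
    have "(LINT w|lborel. indicator (cbox 0 u) w * abs_g s w) = (\<Prod>h\<in>UNIV. (u $ h) powr s h / s h)"
      using nn_integral_abs_g_box[where s = s and u = u, OF s u01(1)] s
      by (subst integral_eq_nn_integral)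
         (auto simp: abs_g_nonneg intro!: prod_nonneg divide_nonneg_pos enn2real_ennreal)
    also have "\<dots> = (\<Prod>h\<in>UNIV. t powr (\<alpha> $ h)) / P"
      using s by (simp add: u_def powr_powr P_def prod_dividef less_imp_neq[symmetric])
    \<comment> \<open>The side lengths were scaled by \<open>s h\<close> so that the exponents sum
      to 1 here.\<close>
    also have "(\<Prod>h\<in>UNIV. t powr (\<alpha> $ h)) = t"
      using t prob_simplex_sum[OF \<alpha>] by (simp add: powr_sum[symmetric])
    finally have box: "(LINT w|lborel. indicator (cbox 0 u) w * abs_g s w) = t / P" .
    have "k * (t / P) = (LINT w|lborel. k * (indicator (cbox 0 u) w * abs_g s w))"
      by (simp add: box)
    also have "\<dots> \<le> I"
      unfolding I_def
    proof (rule integral_mono)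
      show "integrable lborel (\<lambda>w. k * (indicator (cbox 0 u) w * abs_g s w))"
        using s by (intro integrable_mult_right integrable_indicator_abs_g) auto
      show "k * (indicator (cbox 0 u) w * abs_g s w) \<le> sop n a w powr (- x) * (indicator W w * abs_g s w)" for w
      \<comment> \<open>On the coordinate hyperplanes the polynomial may vanish, and
        \<open>0 powr (- x) = 0\<close> would break the lower bound; but there \<open>abs_g\<close>
        is 0 and so are both sides.\<close>
      proof (cases "w \<in> cbox 0 u \<and> abs_g s w \<noteq> 0")
        case True
        then have nz: "w $ h \<noteq> 0" for h by (auto simp: abs_g_def)
        have w: "0 \<le> w $ h" "w $ h \<le> u $ h" for h using True by (auto simp: mem_box_cart)
        have "w $ h > 0" for h using nz[of h] w(1)[of h] by linarith
        then have "sop n a w > 0"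
          unfolding sop_def using n by (intro sum_pos prod_pos zero_less_power) auto
        moreover have "sop n a w \<le> real n * t powr m"
          using w by (intro sop_le_on_box[OF t m]) (auto simp: u_def)
        ultimately have "k \<le> sop n a w powr (- x)"
          unfolding k_def using x by (intro powr_mono2') auto
        moreover have "w \<in> W" using True sub by auto
        ultimately show ?thesis
          using True by (simp add: mult_right_mono abs_g_nonneg)
      qed (auto simp: indicator_def abs_g_nonneg)
    qed (rule int)
    also have "k * (t / P) = C * t powr (1 - m * x)"
      using t n by (simp add: k_def C_def powr_mult powr_powr powr_diff powr_minus divide_inverse mult_ac)
    finally show ?thesis .
  qed
  define e where "e = m * x - 1"
  have e: "e > 0" using x by (simp add: e_def)
  define Q where "Q = max 1 (I / C + 1)"
  have Q: "Q \<ge> 1" "Q > I / C" by (auto simp: Q_def)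
  \<comment> \<open>Chosen so that \<open>t powr (1 - m * x)\<close> is \<open>Q\<close>, which
    exceeds \<open>I / C\<close>; \<open>Q \<ge> 1\<close> ensures \<open>t \<le> 1\<close>.\<close>
  define t where "t = Q powr (- 1 / e)"
  have t: "0 < t" "t \<le> 1"
    using Q e by (auto simp: t_def intro: powr_le_one_le[OF _ _ ] powr_mono[of "-1/e" 0 Q, simplified])
  have "t powr (1 - m * x) = Q"
    using Q e by (simp add: t_def powr_powr e_def[symmetric] minus_diff_eq[of "m * x" 1, symmetric])
  with lower[OF t] C have "Q \<le> I / C" by (simp add: pos_le_divide_eq mult.commute)
  with Q show False by simp
qed

text \<open>If \<open>p h\<close> were odd, a point with negative coordinate \<open>h\<close> would
  make the first monomial negative. Scaling a coordinate \<open>k\<close> in which the exponents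
  differ makes it outweigh the second one.\<close>

lemma even_exponent_of_nonneg_two_monomials:
  fixes a :: "'d::finite \<Rightarrow> nat \<Rightarrow> nat"
  assumes nonneg: "\<And>w :: real ^ 'd. (\<Prod>h\<in>UNIV. (w $ h) ^ p h) + (\<Prod>h\<in>UNIV. (w $ h) ^ q h) \<ge> 0"
    and neq: "p \<noteq> q"
  shows "even (p h)"
proof (rule ccontr)
  assume odd: "odd (p h)"
  obtain k where k: "p k \<noteq> q k" using neq by auto
  define c :: real where "c = (if p k > q k then 2 else 1 / 2)"
  \<comment> \<open>The sign and the scaling are separate factors, so that \<open>h = k\<close>
    needs no special treatment.\<close>
  define w :: "real ^ 'd" where "w = (\<chi> i. (if i = h then - 1 else 1) * (if i = k then c else 1))"
  have prod_w: "(\<Prod>i\<in>UNIV. (w $ i) ^ r i) = (- 1) ^ r h * c ^ r k" for r :: "'d \<Rightarrow> nat"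
  proof -
    have "(\<Prod>i\<in>UNIV. (w $ i) ^ r i) =
        (\<Prod>i\<in>UNIV. if i = h then (- 1) ^ r i else 1) * (\<Prod>i\<in>UNIV. if i = k then c ^ r i else 1)"
      unfolding prod.distrib[symmetric] w_def by (intro prod.cong) (auto simp: power_mult_distrib)
    then show ?thesis by simp
  qed
  have "c ^ q k < c ^ p k"
    using k by (auto simp: c_def intro: power_strict_increasing power_strict_decreasing)
  moreover have "(- 1) ^ q h * c ^ q k \<le> 1 * c ^ q k"
    by (intro mult_right_mono) (cases "even (q h)"; auto simp: c_def)+
  ultimately have "(- 1) ^ p h * c ^ p k + (- 1) ^ q h * c ^ q k < 0" using odd by simp
  then show False using nonneg[of w] by (simp add: prod_w)
qed

lemma sop_2: "sop 2 a w = (\<Prod>h\<in>UNIV. (w $ h) ^ a h 1) + (\<Prod>h\<in>UNIV. (w $ h) ^ a h 2)"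
proof -
  have "{1..2::nat} = {1, 2}" by auto
  then show ?thesis by (simp add: sop_def)
qed

lemma even_exponents_two_terms:
  fixes a :: "'d::finite \<Rightarrow> nat \<Rightarrow> nat"
  assumes "nonneg_sop 2 a" "j \<in> {1..2}"
  shows "even (a h j)"
proof -
  have neq: "(\<lambda>h. a h 1) \<noteq> (\<lambda>h. a h 2)"
    using assms(1) inj_onD[of "\<lambda>j h. a h j" "{1..2}" 1 2] by (auto simp: nonneg_sop_def)
  have "(\<Prod>h\<in>UNIV. (w $ h) ^ a h 1) + (\<Prod>h\<in>UNIV. (w $ h) ^ a h 2) \<ge> 0" for w :: "real ^ 'd"
    using sop_nonneg[OF assms(1), of w] by (simp only: sop_2)
  then have "even (a h 1)" "even (a h 2)"
    using even_exponent_of_nonneg_two_monomials[of "\<lambda>h. a h 1" "\<lambda>h. a h 2" h] even_exponent_of_nonneg_two_monomials[of "\<lambda>h. a h 2" "\<lambda>h. a h 1" h] neq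
    by (auto simp: add.commute)
  moreover have "j = 1 \<or> j = 2" using assms(2) by auto
  ultimately show ?thesis by auto
qed

text \<open>Taking logarithms, \<open>exists_term_le_maxmin\<close> yields a term, depending on
  \<open>w\<close>, that dominates the monomial. Evenness makes the other terms non-negative, so
  this one bounds the sum from below.\<close>

lemma sop_ge_monomial:
  fixes w :: "real ^ 'd::finite"
  assumes n: "n \<ge> 1" and s: "\<And>h. s h > 0"
    and even: "\<And>h j. j \<in> {1..n} \<Longrightarrow> even (a h j)"
    and R: "R \<ge> 1" and w: "\<And>h. w $ h \<noteq> 0" "\<And>h. \<bar>w $ h\<bar> \<le> R"
  shows "(\<Prod>h\<in>UNIV. (\<bar>w $ h\<bar> / R) powr (maxmin n a s * s h)) \<le> sop n a w"
proof -
  define M where "M = maxmin n a s"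
  define L where "L h = ln (\<bar>w $ h\<bar> / R)" for h
  \<comment> \<open>Division by \<open>R\<close> makes the logarithms non-positive, so that
    \<open>y\<close> is non-negative as required.\<close>
  define y where "y h = - (s h * L h)" for h
  have pos: "\<bar>w $ h\<bar> / R > 0" for h using w(1)[of h] R by simp
  have "L h \<le> 0" for h
    using pos[of h] w(2)[of h] R by (simp add: L_def)
  then have y: "y h \<ge> 0" for h using s[of h] by (simp add: y_def mult_nonneg_nonpos)
  obtain j where j: "j \<in> {1..n}" "(\<Sum>h\<in>UNIV. y h * (real (a h j) / s h)) \<le> M * (\<Sum>h\<in>UNIV. y h)"
    using exists_term_le_maxmin[where a = a and s = s and y = y, OF n s y] by (auto simp: M_def)
  have "y h * (real (a h j) / s h) = - (real (a h j) * L h)" for h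
    using s[of h] by (simp add: y_def)
  with j(2) have le: "(\<Sum>h\<in>UNIV. M * s h * L h) \<le> (\<Sum>h\<in>UNIV. real (a h j) * L h)"
    by (simp add: y_def sum_negf sum_distrib_left mult.assoc)
  have "(\<Prod>h\<in>UNIV. (\<bar>w $ h\<bar> / R) powr (M * s h)) = exp (\<Sum>h\<in>UNIV. M * s h * L h)"
    using pos R w(1) by (simp add: powr_def exp_sum L_def)
  also have "\<dots> \<le> exp (\<Sum>h\<in>UNIV. real (a h j) * L h)" using le by simp
  also have "\<dots> = (\<Prod>h\<in>UNIV. (\<bar>w $ h\<bar> / R) ^ a h j)"
    using pos by (simp add: exp_sum exp_of_nat_mult L_def)
  also have "\<dots> \<le> (\<Prod>h\<in>UNIV. \<bar>w $ h\<bar> ^ a h j)"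
    using R pos by (intro prod_mono conjI power_mono) (auto simp: divide_le_eq mult_le_cancel_left1)
  also have "\<dots> = (\<Prod>h\<in>UNIV. (w $ h) ^ a h j)"
    using even[OF j(1)] by (simp add: power_even_abs)
  also have "\<dots> \<le> sop n a w"
    unfolding sop_def using j(1) even by (intro member_le_sum) (auto intro!: prod_nonneg zero_le_even_power)
  finally show ?thesis by (simp add: M_def)
qed

text \<open>The monomial bound majorises the integrand by a constant times \<open>abs_g\<close> with
  exponents \<open>s' h\<close>, shrunk by the factor \<open>1 - M * x\<close> but still positive.
  The powers of \<open>R\<close> are collected in \<open>C\<close>.\<close>

lemma integrable_neg_powr:
  fixes a :: "'d::finite \<Rightarrow> nat \<Rightarrow> nat"
  assumes n: "n \<ge> 1" and s: "\<And>h. s h > 0" and W: "compact W"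
    and even: "\<And>h j. j \<in> {1..n} \<Longrightarrow> even (a h j)"
    and x: "x > 0" "maxmin n a s * x < 1"
  shows "integrable lborel (\<lambda>w. sop n a w powr (- x) * (indicator W w * abs_g s w))"
proof -
  have [measurable]: "W \<in> sets borel" using W by (simp add: borel_compact)
  define M where "M = maxmin n a s"
  obtain R where R: "R \<ge> 1" "\<And>w h. w \<in> W \<Longrightarrow> \<bar>w $ h\<bar> \<le> R"
  proof -
    obtain R where R: "\<And>w. w \<in> W \<Longrightarrow> norm w \<le> R"
      using compact_imp_bounded[OF W] by (auto simp: bounded_iff)
    have "\<bar>w $ h\<bar> \<le> max 1 R" if "w \<in> W" for w :: "real ^ 'd" and h
      using R[OF that] component_le_norm_cart[of w h] by linarith
    then show ?thesis using that[of "max 1 R"] by auto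
  qed
  define s' where "s' h = s h * (1 - M * x)" for h
  have s': "s' h > 0" for h using s[of h] x by (simp add: s'_def M_def)
  define C where "C = (\<Prod>h\<in>UNIV. R powr (M * s h * x))"
  have C: "C \<ge> 0" unfolding C_def by (intro prod_nonneg) auto
  show ?thesis
  proof (rule Bochner_Integration.integrable_bound)
    show "integrable lborel (\<lambda>w. C * (indicator W w * abs_g s' w))"
      using s' W by (intro integrable_mult_right integrable_indicator_abs_g)
    have "sop n a w powr (- x) * abs_g s w \<le> C * abs_g s' w" if "w \<in> W" for w
    proof (cases "abs_g s w = 0")
      case False
      then have nz: "w $ h \<noteq> 0" for h by (auto simp: abs_g_def)
      have pos: "(\<Prod>h\<in>UNIV. (\<bar>w $ h\<bar> / R) powr (M * s h)) > 0"
        using nz R(1) by (intro prod_pos) auto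
      have "sop n a w powr (- x) \<le> (\<Prod>h\<in>UNIV. (\<bar>w $ h\<bar> / R) powr (M * s h)) powr (- x)"
        using x pos sop_ge_monomial[where a = a and s = s and w = w, OF n s even R(1) nz R(2)[OF that]]
        by (intro powr_mono2') (auto simp: M_def)
      also have "\<dots> = (\<Prod>h\<in>UNIV. (\<bar>w $ h\<bar> / R) powr (- (M * s h * x)))"
        by (subst prod_powr_distrib) (auto simp: powr_powr)
      finally have "sop n a w powr (- x) * abs_g s w
          \<le> (\<Prod>h\<in>UNIV. (\<bar>w $ h\<bar> / R) powr (- (M * s h * x))) * abs_g s w"
        using abs_g_nonneg by (rule mult_right_mono)
      also have "\<dots> = (\<Prod>h\<in>UNIV. R powr (M * s h * x) * \<bar>w $ h\<bar> powr (s' h - 1))"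
        unfolding abs_g_def prod.distrib[symmetric]
      proof (intro prod.cong refl)
        fix h
        have "\<bar>w $ h\<bar> powr (s' h - 1) = \<bar>w $ h\<bar> powr (- (M * s h * x)) * \<bar>w $ h\<bar> powr (s h - 1)"
          by (simp add: powr_add[symmetric] s'_def algebra_simps)
        moreover have "(\<bar>w $ h\<bar> / R) powr (- (M * s h * x))
            = R powr (M * s h * x) * \<bar>w $ h\<bar> powr (- (M * s h * x))"
          using R(1) nz[of h] by (simp add: powr_divide powr_minus[of _ "M * s h * x"] divide_simps)
        ultimately show "(\<bar>w $ h\<bar> / R) powr (- (M * s h * x)) * \<bar>w $ h\<bar> powr (s h - 1) =
            R powr (M * s h * x) * \<bar>w $ h\<bar> powr (s' h - 1)"
          by simp
      qed
      also have "\<dots> = C * abs_g s' w" by (simp add: C_def abs_g_def prod.distrib)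
      finally show ?thesis .
    qed (use mult_nonneg_nonneg[OF C abs_g_nonneg] in auto)
    then show "AE w in lborel. norm (sop n a w powr (- x) * (indicator W w * abs_g s w))
        \<le> norm (C * (indicator W w * abs_g s' w))"
      using C by (intro AE_I2) (auto simp: indicator_def abs_mult abs_g_nonneg)
  qed measurable
qed

subsection \<open>The largest pole\<close>

text \<open>Otherwise some \<open>x' < x\<close> still has \<open>m * x' > 1\<close>. The absence of
  poles forces convergence at \<open>- x'\<close>, which contradicts
  \<open>not_integrable_neg_powr\<close>.\<close>

lemma no_larger_pole_imp_maxmin_le:
  fixes a :: "'d::finite \<Rightarrow> nat \<Rightarrow> nat"
  assumes sop: "nonneg_sop n a" and s: "\<And>h. s h > 0" and W: "compact W" "cbox 0 (\<chi> h. 1) \<subseteq> W"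
    and \<zeta>: "zeta_continuation n a s W \<zeta>"
    and no_pole: "\<And>p. is_pole \<zeta> p \<Longrightarrow> Re p \<le> - x" and x: "x > 0"
  shows "maxmin n a s * x \<le> 1"
proof (rule ccontr)
  assume "\<not> maxmin n a s * x \<le> 1"
  then have "1 / x < maxmin n a s" using x by (simp add: divide_less_eq)
  have n: "n \<ge> 1" using sop by (simp add: nonneg_sop_def)
  then obtain \<alpha> where \<alpha>: "\<alpha> \<in> prob_simplex" "1 / x < simplex_min n a s \<alpha>"
    using s \<open>1 / x < maxmin n a s\<close> by (rule less_maxmin_ex)
  define m where "m = simplex_min n a s \<alpha>"
  have m: "m > 0" "1 / m < x"
    using \<alpha>(2) x less_trans[of 0 "1 / x" m] by (auto simp: m_def divide_less_eq mult.commute)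
  then obtain x' where x': "1 / m < x'" "x' < x" using dense by blast
  have "x' > 0" using m(1) x'(1) less_trans[of 0 "1 / m" x'] by simp
  have "m * x' > 1" using m(1) x'(1) by (simp add: divide_less_eq mult.commute)
  interpret mellin_continuation lborel "sop n a" "\<lambda>w. indicator W w * abs_g s w" \<zeta>
    by (rule mellin_continuation_sop) fact+
  have "integrable lborel (\<lambda>w. sop n a w powr (1 - (1 + x')) * (indicator W w * abs_g s w))"
  proof (rule integrable_of_no_pole)
    \<comment> \<open>The disc of radius \<open>1 + x\<close> around 1 lies in the half-plane
      \<open>Re p > - x\<close>.\<close>
    show "\<not> is_pole \<zeta> p" if "norm (p - 1) < 1 + x" for p
      using no_pole[of p] abs_Re_le_cmod[of "p - 1"] that by (auto simp: abs_le_iff)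
  qed (use x' \<open>x' > 0\<close> in auto)
  moreover have "\<not> integrable lborel (\<lambda>w. sop n a w powr (- x') * (indicator W w * abs_g s w))"
    by (rule not_integrable_neg_powr[OF n s W \<alpha>(1), of m]) (use \<open>m * x' > 1\<close> \<open>x' > 0\<close> in \<open>auto simp: m_def\<close>)
  ultimately show False by simp
qed

text \<open>Otherwise the integral converges at \<open>- x'\<close> for some \<open>x'\<close>
  slightly beyond \<open>x\<close>, and the open disc around 1 up to \<open>- x'\<close> contains
  \<open>- x\<close> but no pole.\<close>

lemma even_pole_imp_maxmin_ge:
  fixes a :: "'d::finite \<Rightarrow> nat \<Rightarrow> nat"
  assumes sop: "nonneg_sop n a" and s: "\<And>h. s h > 0" and W: "compact W"
    and even: "\<And>h j. j \<in> {1..n} \<Longrightarrow> even (a h j)"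
    and \<zeta>: "zeta_continuation n a s W \<zeta>"
    and pole: "is_pole \<zeta> (- complex_of_real x)" and x: "x > 0"
  shows "maxmin n a s * x \<ge> 1"
proof (rule ccontr)
  assume less: "\<not> maxmin n a s * x \<ge> 1"
  have n: "n \<ge> 1" using sop by (simp add: nonneg_sop_def)
  have M: "maxmin n a s \<ge> 0" using n s by (rule maxmin_nonneg)
  obtain x' where x': "x < x'" "maxmin n a s * x' < 1"
  proof (cases "maxmin n a s = 0")
    case True
    then show ?thesis using that[of "x + 1"] by simp
  next
    case False
    with M less obtain x' where "x < x'" "x' < 1 / maxmin n a s"
      using dense[of x "1 / maxmin n a s"] by (auto simp: less_divide_eq mult.commute)
    then show ?thesis using that M False by (auto simp: less_divide_eq mult.commute)
  qed
  interpret mellin_continuation lborel "sop n a" "\<lambda>w. indicator W w * abs_g s w" \<zeta>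
    by (rule mellin_continuation_sop) fact+
  have "integrable lborel (\<lambda>w. sop n a w powr (1 - (1 + x')) * (indicator W w * abs_g s w))"
    using integrable_neg_powr[where a = a and s = s and x = x', OF n s W even] x x' by simp
  moreover have "norm (- complex_of_real x - 1) < 1 + x'"
  proof -
    have eq: "- complex_of_real x - 1 = of_real (- x - 1)" by simp
    show ?thesis unfolding eq norm_of_real using x x' by simp
  qed
  ultimately show False using not_pole_of_integrable pole by blast
qed

lemma largest_pole_positive:
  assumes sop: "nonneg_sop n a" and s: "\<And>h. s h > 0" and W: "compact W"
    and \<zeta>: "zeta_continuation n a s W \<zeta>" and pole: "is_pole \<zeta> (- complex_of_real x)"
  shows "x > 0"
proof (rule ccontr)
  assume "\<not> x > 0"
  interpret mellin_continuation lborel "sop n a" "\<lambda>w. indicator W w * abs_g s w" \<zeta>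
    by (rule mellin_continuation_sop) fact+
  show False using not_pole_nonneg[of "- x"] pole \<open>\<not> x > 0\<close> by simp
qed

theorem mainTheorem2:
  fixes n :: nat and a :: "'d::finite \<Rightarrow> nat \<Rightarrow> nat" and s :: "'d \<Rightarrow> real"
  assumes "nonneg_sop n a"
    and "\<And>h. s h > 0"
  shows "\<exists>K :: (real ^ 'd) set. compact K \<and>
    (\<forall>W \<zeta> l. compact W \<and> K \<subseteq> W \<and> zeta_continuation n a s W \<zeta> \<and> largest_pole_at_minus \<zeta> l
       \<longrightarrow> 1 / l \<ge> ereal (maxmin n a s) \<and>
           (n = 2 \<longrightarrow> 1 / l = ereal (maxmin n a s) \<and>
                     1 / l = ereal (two_term_value a s)))"
proof (intro exI[of _ "cbox 0 (\<chi> h. 1)"] conjI allI impI compact_cbox)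
  \<comment> \<open>The unit cube in the positive orthant is large enough: it contains all the boxes
    with \<open>t \<le> 1\<close> used for divergence.\<close>
  fix W \<zeta> l
  assume asm: "compact W \<and> cbox 0 (\<chi> h. 1) \<subseteq> W \<and> zeta_continuation n a s W \<zeta> \<and> largest_pole_at_minus \<zeta> l"
  then have W: "compact W" "cbox 0 (\<chi> h. 1) \<subseteq> W" and \<zeta>: "zeta_continuation n a s W \<zeta>" by auto
  define M where "M = maxmin n a s"
  have n: "n \<ge> 1" using assms(1) by (simp add: nonneg_sop_def)
  have M: "M \<ge> 0" unfolding M_def using n assms(2) by (rule maxmin_nonneg)
  have le: "M * x \<le> 1" if "\<And>p. is_pole \<zeta> p \<Longrightarrow> Re p \<le> - x" "x > 0" for x
    unfolding M_def using assms W \<zeta> that by (rule no_larger_pole_imp_maxmin_le)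
  have "1 / l \<ge> ereal M \<and> (n = 2 \<longrightarrow> 1 / l = ereal M)"
  proof (cases "l = \<infinity>")
    case True
    then have no_pole: "\<not> is_pole \<zeta> p" for p
      using asm by (auto simp: largest_pole_at_minus_def)
    have "M \<le> 0"
    proof (rule ccontr)
      assume "\<not> M \<le> 0"
      \<comment> \<open>Without poles every positive \<open>x\<close> is admissible, and
        \<open>2 / M\<close> would give 2 \<le> 1. Hence \<open>M = 0\<close>, which matches the
        convention 1 / \<infinity> = 0.\<close>
      then show False using le[of "2 / M"] no_pole by simp
    qed
    with M True show ?thesis by (simp add: zero_ereal_def)
  next
    case False
    then obtain x where l: "l = ereal x" and pole: "is_pole \<zeta> (- complex_of_real x)"
      and largest: "\<And>p. is_pole \<zeta> p \<Longrightarrow> Re p \<le> - x"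
      using asm by (auto simp: largest_pole_at_minus_def)
    have x: "x > 0"
      using assms W(1) \<zeta> pole by (rule largest_pole_positive)
    have inv: "1 / l = ereal (1 / x)" using l x by (simp add: one_ereal_def)
    have "M \<le> 1 / x" using le[OF largest x] x by (simp add: le_divide_eq)
    moreover have "M = 1 / x" if "n = 2"
    proof -
      have "maxmin n a s * x \<ge> 1"
        using assms W(1) _ \<zeta> pole x
        by (rule even_pole_imp_maxmin_ge) (use assms(1) that in \<open>auto intro: even_exponents_two_terms\<close>)
      then show ?thesis using \<open>M \<le> 1 / x\<close> x by (simp add: M_def field_simps)
    qed
    ultimately show ?thesis unfolding inv by simp
  qed
  then show "1 / l \<ge> ereal (maxmin n a s)" and "n = 2 \<Longrightarrow> 1 / l = ereal (maxmin n a s)"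
    and "n = 2 \<Longrightarrow> 1 / l = ereal (two_term_value a s)"
    using maxmin_2_eq_two_term_value[where a = a and s = s, OF assms(2)] by (auto simp: M_def)
qed

end
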